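(* Assume that $0<\beta<1$ and let $p=p(N)\in(0,1]$ be such that $pN\to\infty$ as $N\to\infty$. Then $L_N$, considered as a random element of $\mathcal M(\mathbb R)$, converges in probability to $\mathfrak N_{0,1/(1-\beta)}$. That is, for every $\varepsilon>0$, $$\lim_{N\to\infty}\mathbb P\big[d_L(L_N,\mathfrak N_{0,1/(1-\beta)})>\varepsilon\big]=0.$$
   Context: For each $N$ and $p=p(N)\in(0,1]$, let $(\varepsilon_{i,j})_{i,j=1}^N$ be independent random variables with $\mathbb P[\varepsilon_{i,j}=1]=p$ and $\mathbb P[\varepsilon_{i,j}=0]=1-p$ (indicators of the edges of a directed Erdős–Rényi graph; $i=j$ is allowed). For $\sigma\in\{-1,+1\}^N$ put $$H(\sigma)=-\frac1{2Np}\sum_{i,j=1}^N\varepsilon_{i,j}\sigma_i\sigma_j,\qquad Z_N(\beta)=\sum_{\sigma\in\{-1,+1\}^N}e^{-\beta H(\sigma)}.$$ $\mathcal M(\mathbb R)$ is the space of probability measures on $\mathbb R$ with the weak topology, metrized by the Lévy metric $$d_L(\mu_1,\mu_2)=\inf\{\varepsilon>0:\ \mu_1(-\infty,t-\varepsilon]-\varepsilon\le\mu_2(-\infty,t]\le\mu_1(-\infty,t+\varepsilon]+\varepsilon\ \text{ for all } t\in\mathbb R\}.$$ $L_N$ is the random probability measure (a function of the $\varepsilon_{i,j}$) $$L_N=\frac1{Z_N(\beta)}\sum_{\sigma\in\{-1,+1\}^N}e^{-\beta H(\sigma)}\,\delta_{\frac1{\sqrt N}\sum_{i=1}^N\sigma_i},$$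 where $\delta_x$ is the Dirac measure at $x$. $\mathfrak N_{0,v}$ is the normal distribution with mean $0$ and variance $v$. *)

theory Defs
  imports "HOL-Probability.Probability"
begin

definition configs :: "nat \<Rightarrow> (nat \<Rightarrow> real) set" where
  "configs N = {1..N} \<rightarrow>\<^sub>E {-1, 1}"

definition hamiltonian :: "nat \<Rightarrow> real \<Rightarrow> (nat \<Rightarrow> nat \<Rightarrow> real) \<Rightarrow> (nat \<Rightarrow> real) \<Rightarrow> real" where
  "hamiltonian N p e \<sigma> =
     - (1 / (2 * real N * p)) * (\<Sum>i=1..N. \<Sum>j=1..N. e i j * \<sigma> i * \<sigma> j)"

definition partition_function :: "nat \<Rightarrow> real \<Rightarrow> real \<Rightarrow> (nat \<Rightarrow> nat \<Rightarrow> real) \<Rightarrow> real" where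
  "partition_function N p \<beta> e = (\<Sum>\<sigma>\<in>configs N. exp (- \<beta> * hamiltonian N p e \<sigma>))"

text \<open>
  The measure \<open>L\<^sub>N\<close> for a fixed realisation \<open>e\<close> of the edge indicators, as a weighted sum of
  the Dirac measures \<^term>\<open>return borel\<close>.
  Lemma \<open>emeasure_magnetization_law\<close> confirms that \<^const>\<open>measure_of\<close> does not fall back
  to the null measure.
\<close>
definition magnetization_law ::
    "nat \<Rightarrow> real \<Rightarrow> real \<Rightarrow> (nat \<Rightarrow> nat \<Rightarrow> real) \<Rightarrow> real measure" where
  "magnetization_law N p \<beta> e = measure_of UNIV (sets borel)
     (\<lambda>A. \<Sum>\<sigma>\<in>configs N.
        ennreal (1 / partition_function N p \<beta> e * exp (- \<beta> * hamiltonian N p e \<sigma>)) *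
        emeasure (return borel (1 / sqrt (real N) * (\<Sum>i=1..N. \<sigma> i))) A)"

definition levy_dist :: "real measure \<Rightarrow> real measure \<Rightarrow> real" where
  "levy_dist \<mu>1 \<mu>2 = Inf {\<epsilon>. \<epsilon> > 0 \<and>
     (\<forall>t. measure \<mu>1 {..t - \<epsilon>} - \<epsilon> \<le> measure \<mu>2 {..t} \<and>
          measure \<mu>2 {..t} \<le> measure \<mu>1 {..t + \<epsilon>} + \<epsilon>)}"

text \<open>\<^const>\<open>normal_density\<close> takes the standard deviation, not the variance.\<close>
definition normal_law :: "real \<Rightarrow> real \<Rightarrow> real measure" where
  "normal_law m v = density lborel (\<lambda>x. ennreal (normal_density m (sqrt v) x))"


lemma finite_configs [simp]: "finite (configs N)"
  unfolding configs_def by (intro finite_PiE) auto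

lemma configs_nonempty: "configs N \<noteq> {}"
  unfolding configs_def by (simp add: PiE_eq_empty_iff)

lemma partition_function_pos: "partition_function N p \<beta> e > 0"
  unfolding partition_function_def by (intro sum_pos configs_nonempty) auto

lemma space_magnetization_law [simp]: "space (magnetization_law N p \<beta> e) = UNIV"
  unfolding magnetization_law_def by (simp add: space_measure_of_conv)

lemma sets_magnetization_law [simp, measurable_cong]:
  "sets (magnetization_law N p \<beta> e) = sets borel"
  unfolding magnetization_law_def
  by (simp add: sets.sigma_sets_eq[of borel, simplified])

lemma emeasure_magnetization_law:
  assumes "A \<in> sets borel"
  shows "emeasure (magnetization_law N p \<beta> e) A =
    (\<Sum>\<sigma>\<in>configs N.
       ennreal (1 / partition_function N p \<beta> e * exp (- \<beta> * hamiltonian N p e \<sigma>)) *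
       emeasure (return borel (1 / sqrt (real N) * (\<Sum>i=1..N. \<sigma> i))) A)"
proof (rule emeasure_measure_of[OF magnetization_law_def])
  let ?f = "\<lambda>A. \<Sum>\<sigma>\<in>configs N.
       ennreal (1 / partition_function N p \<beta> e * exp (- \<beta> * hamiltonian N p e \<sigma>)) *
       emeasure (return borel (1 / sqrt (real N) * (\<Sum>i=1..N. \<sigma> i))) A"
  show "positive (sets (magnetization_law N p \<beta> e)) ?f"
    by (simp add: positive_def)
  show "countably_additive (sets (magnetization_law N p \<beta> e)) ?f"
  proof (rule countably_additiveI)
    fix A :: "nat \<Rightarrow> real set"
    assume A: "range A \<subseteq> sets (magnetization_law N p \<beta> e)" "disjoint_family A"
    have r: "(\<Sum>i. emeasure (return borel (x::real)) (A i)) = emeasure (return borel x) (\<Union>i. A i)" for x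
      using A by (intro suminf_emeasure) auto
    show "(\<Sum>i. ?f (A i)) = ?f (\<Union>i. A i)"
      by (subst suminf_sum) (simp_all only: summableI ennreal_suminf_cmult r)
  qed
qed (use assms in auto)

lemma prob_space_magnetization_law: "prob_space (magnetization_law N p \<beta> e)"
proof
  have "(\<Sum>\<sigma>\<in>configs N. 1 / partition_function N p \<beta> e * exp (- \<beta> * hamiltonian N p e \<sigma>)) = 1"
    using partition_function_pos[of N p \<beta> e]
    by (simp add: sum_divide_distrib[symmetric]) (simp add: partition_function_def)
  moreover have "emeasure (return borel (x::real)) UNIV = 1" for x by simp
  ultimately show "emeasure (magnetization_law N p \<beta> e) (space (magnetization_law N p \<beta> e)) = 1"
    using partition_function_pos[of N p \<beta> e]
    by (simp add: emeasure_magnetization_law sum_ennreal less_imp_le)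
qed

lemma prob_space_normal_law: "v > 0 \<Longrightarrow> prob_space (normal_law m v)"
  unfolding normal_law_def by (intro prob_space_normal_density) simp

lemma measure_magnetization_law:
  assumes "A \<in> sets borel"
  shows "measure (magnetization_law N p \<beta> e) A =
    (\<Sum>\<sigma>\<in>configs N. exp (- \<beta> * hamiltonian N p e \<sigma>) / partition_function N p \<beta> e *
       indicator A (1 / sqrt (real N) * (\<Sum>i=1..N. \<sigma> i)))"
proof -
  let ?w = "\<lambda>\<sigma>. exp (- \<beta> * hamiltonian N p e \<sigma>) / partition_function N p \<beta> e"
  have "emeasure (magnetization_law N p \<beta> e) A =
    (\<Sum>\<sigma>\<in>configs N. ennreal (?w \<sigma> * indicator A (1 / sqrt (real N) * (\<Sum>i=1..N. \<sigma> i))))"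
    unfolding emeasure_magnetization_law[OF assms] emeasure_return[OF assms]
    using partition_function_pos[of N p \<beta> e]
    by (intro sum.cong) (auto simp: indicator_def)
  also have "\<dots> = ennreal (\<Sum>\<sigma>\<in>configs N. ?w \<sigma> * indicator A (1 / sqrt (real N) * (\<Sum>i=1..N. \<sigma> i)))"
    using partition_function_pos[of N p \<beta> e] by (intro sum_ennreal) (auto simp: less_imp_le)
  finally show ?thesis
    using partition_function_pos[of N p \<beta> e]
    by (simp add: measure_def sum_nonneg less_imp_le)
qed

lemma levy_dist_lipschitz:
  assumes "prob_space \<mu>" "prob_space \<mu>'" "prob_space \<nu>" and sets_nu: "sets \<nu> = sets borel"
    and close: "\<And>t. \<bar>measure \<mu> {..t} - measure \<mu>' {..t}\<bar> \<le> d"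
  shows "levy_dist \<mu> \<nu> \<le> levy_dist \<mu>' \<nu> + d"
proof -
  let ?S = "\<lambda>\<mu>. {\<epsilon>. \<epsilon> > 0 \<and> (\<forall>t. measure \<mu> {..t - \<epsilon>} - \<epsilon> \<le> measure \<nu> {..t} \<and>
          measure \<nu> {..t} \<le> measure \<mu> {..t + \<epsilon>} + \<epsilon>)}"
  interpret mu': prob_space \<mu>' by fact
  interpret mu: prob_space \<mu> by fact
  interpret nu: prob_space \<nu> by fact
  have d: "d \<ge> 0" using close[of 0] by linarith
  have bdd: "bdd_below (?S \<mu>)" by (rule bdd_belowI[of _ 0]) auto
  have "measure \<mu>' {..t - 1} - 1 \<le> measure \<nu> {..t}" "measure \<nu> {..t} \<le> measure \<mu>' {..t + 1} + 1" for t
    using mu'.prob_le_1[of "{..t - 1}"] nu.prob_le_1[of "{..t}"]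
      measure_nonneg[of \<nu> "{..t}"] measure_nonneg[of \<mu>' "{..t + 1}"] by linarith+
  then have "1 \<in> ?S \<mu>'" by simp
  then have ne: "?S \<mu>' \<noteq> {}" by blast
  have "Inf (?S \<mu>) - d \<le> Inf (?S \<mu>')"
  proof (rule cInf_greatest[OF ne])
    fix x assume x: "x \<in> ?S \<mu>'"
    have "measure \<mu> {..t - (x + d)} - (x + d) \<le> measure \<nu> {..t} \<and>
          measure \<nu> {..t} \<le> measure \<mu> {..t + (x + d)} + (x + d)" for t
    proof
      have "measure \<mu> {..t - (x + d)} - (x + d) \<le> measure \<mu>' {..(t - d) - x} - x"
        using close[of "t - (x + d)"] by (simp add: algebra_simps)
      also have "\<dots> \<le> measure \<nu> {..t - d}" using x by auto
      also have "\<dots> \<le> measure \<nu> {..t}"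
        using d sets_nu by (intro nu.finite_measure_mono) auto
      finally show "measure \<mu> {..t - (x + d)} - (x + d) \<le> measure \<nu> {..t}" .
    next
      have "measure \<nu> {..t} \<le> measure \<nu> {..t + d}"
        using d sets_nu by (intro nu.finite_measure_mono) auto
      also have "\<dots> \<le> measure \<mu>' {..(t + d) + x} + x" using x by auto
      also have "\<dots> \<le> measure \<mu> {..t + (x + d)} + (x + d)"
        using close[of "t + (x + d)"] by (simp add: algebra_simps)
      finally show "measure \<nu> {..t} \<le> measure \<mu> {..t + (x + d)} + (x + d)" .
    qed
    then have "x + d \<in> ?S \<mu>" using x d by auto
    then have "Inf (?S \<mu>) \<le> x + d" by (rule cInf_lower[OF _ bdd])
    then show "Inf (?S \<mu>) - d \<le> x" by simp
  qed
  then show ?thesis unfolding levy_dist_def by simp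
qed

lemma borel_measurable_lipschitz_comp:
  fixes f :: "'b \<Rightarrow> real" and w :: "'c \<Rightarrow> 'b \<Rightarrow> real"
  assumes S: "finite S" and w: "\<And>s. s \<in> S \<Longrightarrow> w s \<in> borel_measurable M"
    and lip: "\<And>x y. f x \<le> f y + (\<Sum>s\<in>S. \<bar>w s x - w s y\<bar>)"
  shows "f \<in> borel_measurable M"
proof (rule borel_measurableI_less)
  fix c :: real
  define B where "B = (\<lambda>(q, k::nat). {x \<in> space M. (\<Sum>s\<in>S. \<bar>w s x - q s\<bar>) < 1 / real (Suc k)})"
  define G where "G = {(q, k) \<in> (S \<rightarrow>\<^sub>E \<rat>) \<times> UNIV. \<exists>x0. (\<Sum>s\<in>S. \<bar>w s x0 - q s\<bar>) < 1 / real (Suc k)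
      \<and> f x0 < c - 2 / real (Suc k)}"
  have "countable ((S \<rightarrow>\<^sub>E (\<rat> :: real set)) \<times> (UNIV :: nat set))"
    using S countable_rat by (intro countable_SIGMA countable_PiE) auto
  then have "countable G" by (rule countable_subset[rotated]) (auto simp: G_def)
  moreover have "B g \<in> sets M" for g
    unfolding B_def using w by (cases g) (simp, measurable)
  ultimately have "(\<Union>g\<in>G. B g) \<in> sets M" by (intro sets.countable_UN'') auto
  moreover have "(\<Union>g\<in>G. B g) = {x \<in> space M. f x < c}"
  proof (intro equalityI subsetI)
    fix x assume "x \<in> (\<Union>g\<in>G. B g)"
    then obtain q k x0 where x: "x \<in> space M" "(\<Sum>s\<in>S. \<bar>w s x - q s\<bar>) < 1 / real (Suc k)"
      and x0: "(\<Sum>s\<in>S. \<bar>w s x0 - q s\<bar>) < 1 / real (Suc k)" "f x0 < c - 2 / real (Suc k)"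
      unfolding B_def G_def by auto
    have "(\<Sum>s\<in>S. \<bar>w s x - w s x0\<bar>) \<le> (\<Sum>s\<in>S. \<bar>w s x - q s\<bar> + \<bar>w s x0 - q s\<bar>)"
      by (intro sum_mono) linarith
    with x x0 lip[of x x0] show "x \<in> {x \<in> space M. f x < c}"
      by (simp add: sum.distrib)
  next
    fix x assume x: "x \<in> {x \<in> space M. f x < c}"
    then obtain k where "inverse (real (Suc k)) < (c - f x) / 2"
      using reals_Archimedean[of "(c - f x) / 2"] by auto
    then have k: "f x < c - 2 / real (Suc k)" by (simp add: field_simps)
    define \<delta> where "\<delta> = 1 / (real (Suc k) * real (Suc (card S)))"
    have "\<delta> > 0" by (simp add: \<delta>_def)
    then have "\<exists>r\<in>\<rat>. \<bar>w s x - r\<bar> < \<delta>" for s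
      using Rats_dense_in_real[of "w s x - \<delta>" "w s x"] by force
    then obtain q0 where q0: "\<And>s. q0 s \<in> \<rat>" "\<And>s. \<bar>w s x - q0 s\<bar> < \<delta>" by metis
    have "(\<Sum>s\<in>S. \<bar>w s x - restrict q0 S s\<bar>) \<le> (\<Sum>s\<in>S. \<delta>)"
      using q0(2) by (intro sum_mono) (simp add: less_imp_le)
    also have "\<dots> = real (card S) * \<delta>" by simp
    also have "\<dots> < real (Suc (card S)) * \<delta>" using \<open>\<delta> > 0\<close> by simp
    also have "\<dots> = 1 / real (Suc k)" unfolding \<delta>_def by (simp del: of_nat_Suc)
    finally have "x \<in> B (restrict q0 S, k)" "(restrict q0 S, k) \<in> G"
      using x k q0(1) unfolding B_def G_def by auto
    then show "x \<in> (\<Union>g\<in>G. B g)" by blast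
  qed
  ultimately show "{x \<in> space M. f x < c} \<in> sets M" by simp
qed

text \<open>
  In particular the events \<open>d\<^sub>L(L\<^sub>N, \<nu>) > \<epsilon>\<close> are measurable, so that their probabilities
  are not junk values of \<^const>\<open>measure\<close>.
\<close>
lemma borel_measurable_levy_dist_magnetization_law:
  fixes e :: "nat \<Rightarrow> nat \<Rightarrow> 'a \<Rightarrow> real"
  assumes e: "\<And>i j. i \<in> {1..N} \<Longrightarrow> j \<in> {1..N} \<Longrightarrow> e i j \<in> borel_measurable M"
    and nu: "prob_space \<nu>" "sets \<nu> = sets borel"
  shows "(\<lambda>\<omega>. levy_dist (magnetization_law N p \<beta> (\<lambda>i j. e i j \<omega>)) \<nu>) \<in> borel_measurable M"
proof (rule borel_measurable_lipschitz_comp)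
  let ?w = "\<lambda>\<sigma> \<omega>. exp (- \<beta> * hamiltonian N p (\<lambda>i j. e i j \<omega>) \<sigma>) /
    partition_function N p \<beta> (\<lambda>i j. e i j \<omega>)"
  let ?L = "\<lambda>\<omega>. magnetization_law N p \<beta> (\<lambda>i j. e i j \<omega>)"
  show "finite (configs N)" by simp
  show "?w \<sigma> \<in> borel_measurable M" for \<sigma>
    unfolding partition_function_def hamiltonian_def using e by measurable
  show "levy_dist (?L x) \<nu> \<le> levy_dist (?L y) \<nu> + (\<Sum>\<sigma>\<in>configs N. \<bar>?w \<sigma> x - ?w \<sigma> y\<bar>)" for x y
  proof (rule levy_dist_lipschitz)
    fix t :: real
    let ?I = "\<lambda>\<sigma>. indicator {..t} (1 / sqrt (real N) * (\<Sum>i=1..N. \<sigma> i)) :: real"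
    have eq: "measure (?L x) {..t} - measure (?L y) {..t} = (\<Sum>\<sigma>\<in>configs N. (?w \<sigma> x - ?w \<sigma> y) * ?I \<sigma>)"
      by (subst (1 2) measure_magnetization_law)
        (simp_all only: sum_subtractf[symmetric] left_diff_distrib atMost_borel)
    have *: "\<bar>a * indicator A b\<bar> \<le> \<bar>a\<bar>" for a b :: real and A by (simp add: indicator_def)
    show "\<bar>measure (?L x) {..t} - measure (?L y) {..t}\<bar> \<le> (\<Sum>\<sigma>\<in>configs N. \<bar>?w \<sigma> x - ?w \<sigma> y\<bar>)"
      unfolding eq by (rule order_trans[OF sum_abs]) (intro sum_mono *)
  qed (use nu prob_space_magnetization_law in auto)
qed

end

theory Submission
  imports Defs
begin

text \<open>
  The Gibbs measure of the random graph is compared with that of the Curie-Weiss model, for which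
  the limit law can be computed.

  Put \<open>\<gamma> = \<beta> / (2 N p)\<close> and \<open>t = tanh \<gamma>\<close>.  Since the indicators \<open>\<epsilon>\<close> are 0 or 1, the
  Boltzmann weight of \<open>\<sigma>\<close> is \<open>W(\<sigma>) = \<Prod>(1 + t \<epsilon>\<^sub>i\<^sub>j \<sigma>\<^sub>i \<sigma>\<^sub>j)\<close> times a power of \<open>cosh \<gamma>\<close> that
  depends on the number of edges only and cancels in the Gibbs measure.  This cancellation is
  decisive: for \<open>p\<close> bounded away from 1, the fluctuations of the number of edges contribute to
  the partition function a relative variance of order \<open>1 / (p\<^sup>3 N\<^sup>2)\<close>, which need not be small
  when only \<open>p N \<rightarrow> \<infinity>\<close> is assumed.

  The mean of \<open>W(\<sigma>)\<close> is \<open>\<Prod>(1 + t p \<sigma>\<^sub>i \<sigma>\<^sub>j)\<close>, which is exactly proportional to a Curie-Weiss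
  weight, at inverse temperature \<open>2 N artanh (t p)\<close>, and this tends to \<open>\<beta>\<close>
  (\<open>edge_weight_const\<close>, \<open>effective_temperature_tendsto\<close>).  For two configurations the mean of
  \<open>W(\<sigma>) W(\<tau>)\<close> exceeds the product of the means by at most a factor
  \<open>exp (k (R\<^sup>2 / N + 1))\<close>, where \<open>R = \<Sum>\<sigma>\<^sub>i \<tau>\<^sub>i\<close> is the overlap and \<open>k = 1 / (N p)\<close>
  (\<open>expectation_edge_weight_mult_le\<close>).  For two independent Curie-Weiss configurations with
  \<open>\<beta> < 1\<close>, \<open>R\<^sup>2 / N\<close> has exponential moments bounded in \<open>N\<close>, so that the relative variance
  of a sum of weights is \<open>O(1 / (N p))\<close> (\<open>sum_configs_overlap_le\<close>,
  \<open>sum_edge_weight_variance_le\<close>).  Hence for each Borel set the probability under \<open>L\<^sub>N\<close> is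
  close to its Curie-Weiss value, by a second moment estimate
  (\<open>prob_magnetization_law_deviation_le\<close>).

  The Curie-Weiss magnetization converges to the normal law because its characteristic function is,
  by the Hubbard-Stratonovich transform, a Gaussian integral of \<open>N\<close>-th powers of \<open>cosh\<close>, to
  which dominated convergence applies (\<open>cw_transform_tendsto\<close>,
  \<open>curie_weiss_law_cdf_tendsto\<close>).  Finally, closeness in the Levy distance to a fixed law follows from
  closeness of the distribution functions at finitely many points
  (\<open>levy_dist_le_finite_grid\<close>), and a union bound completes the argument.
\<close>

section \<open>Exponential sums over spin configurations\<close>

lemma configs_sign: "\<sigma> \<in> configs N \<Longrightarrow> i \<in> {1..N} \<Longrightarrow> \<sigma> i = 1 \<or> \<sigma> i = -1"
  by (auto simp: configs_def PiE_iff)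

lemma card_configs: "card (configs N) = 2 ^ N"
  by (simp add: configs_def card_PiE numeral_2_eq_2)

text \<open>
  Under the uniform distribution on configurations the spins are independent, so the sum over
  configurations of a product over the sites factorises.  The parameter \<open>z\<close> is complex when
  characteristic functions are computed; the coefficients \<open>a\<close> are the spins of a second
  configuration when two replicas are compared.
\<close>
lemma sum_configs_exp:
  fixes z :: "'a :: {real_normed_field, banach}"
  shows "(\<Sum>\<sigma>\<in>configs N. exp (z * of_real (\<Sum>i=1..N. a i * \<sigma> i))) =
    2 ^ N * (\<Prod>i=1..N. cosh (z * of_real (a i)))"
proof -
  have "(\<Sum>\<sigma>\<in>configs N. exp (z * of_real (\<Sum>i=1..N. a i * \<sigma> i))) =
    (\<Sum>\<sigma>\<in>configs N. \<Prod>i\<in>{1..N}. exp (z * of_real (a i * \<sigma> i)))"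
    by (simp add: sum_distrib_left exp_sum)
  also have "\<dots> = (\<Prod>i\<in>{1..N}. \<Sum>s\<in>{-1, 1}. exp (z * of_real (a i * s)))"
    unfolding configs_def by (rule prod_sum_PiE[symmetric]) auto
  also have "\<dots> = (\<Prod>i\<in>{1..N}. 2 * cosh (z * of_real (a i)))"
    by (intro prod.cong) (auto simp: cosh_field_def)
  finally show ?thesis by (simp add: prod.distrib)
qed

lemma tanh_le_self: "0 \<le> x \<Longrightarrow> tanh x \<le> (x::real)"
proof -
  assume x: "0 \<le> x"
  have "0 - tanh 0 \<le> x - tanh x"
  proof (rule DERIV_nonneg_imp_nondecreasing[OF x])
    fix y :: real
    have "((\<lambda>y. y - tanh y) has_real_derivative (tanh y)\<^sup>2) (at y)"
      by (auto intro!: derivative_eq_intros)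
    then show "\<exists>d. ((\<lambda>y. y - tanh y) has_real_derivative d) (at y) \<and> 0 \<le> d"
      by (intro exI[of _ "(tanh y)\<^sup>2"]) auto
  qed
  then show ?thesis by simp
qed

text \<open>
  A single spin is sub-Gaussian.  The logarithm of the quotient of the two sides has derivative
  \<open>x - tanh x\<close>, whose sign is that of \<open>x\<close>.
\<close>
lemma cosh_le_exp_half_square: "cosh x \<le> exp (x\<^sup>2 / 2)" for x :: real
proof -
  have *: "cosh x \<le> exp (x\<^sup>2 / 2)" if x: "0 \<le> x" for x :: real
  proof -
    have "0\<^sup>2 / 2 - ln (cosh 0) \<le> x\<^sup>2 / 2 - ln (cosh x)"
    proof (rule DERIV_nonneg_imp_nondecreasing[OF x])
      fix y :: real assume "0 \<le> y"
      moreover have "((\<lambda>y. y\<^sup>2 / 2 - ln (cosh y)) has_real_derivative y - tanh y) (at y)"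
        by (auto intro!: derivative_eq_intros simp: tanh_def)
      ultimately show "\<exists>d. ((\<lambda>y. y\<^sup>2 / 2 - ln (cosh y)) has_real_derivative d) (at y) \<and> 0 \<le> d"
        using tanh_le_self[of y] by (intro exI[of _ "y - tanh y"]) auto
    qed
    then have "ln (cosh x) \<le> x\<^sup>2 / 2" by simp
    then have "exp (ln (cosh x)) \<le> exp (x\<^sup>2 / 2)" by (simp only: exp_le_cancel_iff)
    then show ?thesis by simp
  qed
  from *[of "\<bar>x\<bar>"] show ?thesis by simp
qed

section \<open>Gaussian integrals\<close>


lemma std_normal_density_exp_linear:
  "std_normal_density x * exp (c * x) = exp (c\<^sup>2 / 2) * normal_density c 1 x"
proof -
  have "- x\<^sup>2 / 2 + c * x = c\<^sup>2 / 2 + - (x - c)\<^sup>2 / 2"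
    by (simp add: power2_eq_square field_simps)
  then show ?thesis
    by (simp add: normal_density_def exp_add[symmetric])
qed

text \<open>
  Read from right to left this is the Hubbard-Stratonovich transform: a weight quadratic in the
  magnetization becomes a Gaussian mixture of weights linear in it, to which
  \<open>sum_configs_exp\<close> applies.
\<close>
lemma has_bochner_integral_std_normal_exp_linear:
  "has_bochner_integral lborel (\<lambda>x. std_normal_density x * exp (c * x)) (exp (c\<^sup>2 / 2))"
proof -
  have "has_bochner_integral lborel (normal_density c 1) 1"
    by (simp add: has_bochner_integral_iff)
  from has_bochner_integral_mult_right[OF this, of "exp (c\<^sup>2 / 2)"]
  show ?thesis by (simp add: std_normal_density_exp_linear)
qed

lemma std_normal_density_exp_square:
  assumes "a < 1"
  shows "std_normal_density x * exp (a * x\<^sup>2 / 2) =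
    1 / sqrt (1 - a) * normal_density 0 (1 / sqrt (1 - a)) x"
proof -
  have "- x\<^sup>2 / 2 + a * x\<^sup>2 / 2 = - x\<^sup>2 / (2 * (1 / sqrt (1 - a))\<^sup>2)"
    using assms by (simp add: power_divide field_simps)
  moreover have "sqrt (2 * pi * (1 / sqrt (1 - a))\<^sup>2) = sqrt (2 * pi) / sqrt (1 - a)"
    using assms by (simp add: power_divide real_sqrt_divide)
  ultimately show ?thesis
    using assms by (simp add: normal_density_def exp_add[symmetric])
qed

lemma has_bochner_integral_std_normal_exp_square:
  assumes "a < 1"
  shows "has_bochner_integral lborel (\<lambda>x. std_normal_density x * exp (a * x\<^sup>2 / 2)) (1 / sqrt (1 - a))"
proof -
  have "has_bochner_integral lborel (normal_density 0 (1 / sqrt (1 - a))) 1"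
    using assms by (simp add: has_bochner_integral_iff)
  from has_bochner_integral_mult_right[OF this, of "1 / sqrt (1 - a)"]
  show ?thesis using assms by (simp only: std_normal_density_exp_square) simp
qed

lemma char_normal_density:
  assumes "\<sigma> > 0"
  shows "(\<integral>x. normal_density 0 \<sigma> x *\<^sub>R iexp (t * x) \<partial>lborel) = of_real (exp (- (\<sigma>\<^sup>2 * t\<^sup>2) / 2))"
proof -
  have "(\<integral>x. normal_density 0 \<sigma> x *\<^sub>R iexp (t * x) \<partial>lborel) =
    \<sigma> *\<^sub>R (\<integral>x. normal_density 0 \<sigma> (0 + \<sigma> * x) *\<^sub>R iexp (t * (0 + \<sigma> * x)) \<partial>lborel)"
    using assms by (subst lborel_integral_real_affine[where c=\<sigma> and t=0]) auto
  also have "\<dots> = (\<integral>x. std_normal_density x *\<^sub>R iexp ((t * \<sigma>) * x) \<partial>lborel)"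
    using assms unfolding integral_scaleR_right[symmetric]
    by (intro Bochner_Integration.integral_cong)
       (auto simp: normal_density_def power_mult_distrib real_sqrt_mult mult_ac)
  also have "\<dots> = char std_normal_distribution (t * \<sigma>)"
    unfolding char_def by (subst integral_density) auto
  also have "\<dots> = of_real (exp (- (\<sigma>\<^sup>2 * t\<^sup>2) / 2))"
    by (simp add: char_std_normal_distribution power_mult_distrib mult.commute)
  finally show ?thesis .
qed

text \<open>
  For a uniform configuration the normalised magnetization, and likewise its overlap with a fixed
  sign vector \<open>\<tau>\<close>, has square-exponential moments no larger than those of a standard normal
  variable.  After linearising the square, each site contributes a \<open>cosh\<close>, which is at most
  the corresponding Gaussian factor.  The bound does not depend on \<open>N\<close>.
\<close>
lemma sum_configs_exp_square_le:
  assumes a: "0 \<le> a" "a < 1" and \<tau>: "\<And>i. i \<in> {1..N} \<Longrightarrow> \<tau> i = 1 \<or> \<tau> i = -1"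
  shows "(\<Sum>\<sigma>\<in>configs N. exp (a / (2 * real N) * (\<Sum>i=1..N. \<tau> i * \<sigma> i)\<^sup>2)) \<le> 2 ^ N / sqrt (1 - a)"
proof -
  define c where "c = sqrt (a / real N)"
  have c2: "c\<^sup>2 = a / real N" using a by (simp add: c_def)
  have hs: "has_bochner_integral lborel
      (\<lambda>x. \<Sum>\<sigma>\<in>configs N. std_normal_density x * exp (c * (\<Sum>i=1..N. \<tau> i * \<sigma> i) * x))
      (\<Sum>\<sigma>\<in>configs N. exp ((c * (\<Sum>i=1..N. \<tau> i * \<sigma> i))\<^sup>2 / 2))"
    by (intro has_bochner_integral_sum has_bochner_integral_std_normal_exp_linear)
  have "(\<Sum>\<sigma>\<in>configs N. exp (a / (2 * real N) * (\<Sum>i=1..N. \<tau> i * \<sigma> i)\<^sup>2)) =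
      (\<Sum>\<sigma>\<in>configs N. exp ((c * (\<Sum>i=1..N. \<tau> i * \<sigma> i))\<^sup>2 / 2))"
    by (simp add: power_mult_distrib c2 mult_ac)
  also have "\<dots> = (\<integral>x. (\<Sum>\<sigma>\<in>configs N. std_normal_density x * exp (c * (\<Sum>i=1..N. \<tau> i * \<sigma> i) * x)) \<partial>lborel)"
    using has_bochner_integral_integral_eq[OF hs] by simp
  also have "\<dots> \<le> (\<integral>x. 2 ^ N * (std_normal_density x * exp (a * x\<^sup>2 / 2)) \<partial>lborel)"
  proof (rule integral_mono)
    fix x :: real
    have "(\<Sum>\<sigma>\<in>configs N. exp (c * (\<Sum>i=1..N. \<tau> i * \<sigma> i) * x)) =
        2 ^ N * (\<Prod>i=1..N. cosh (c * x * \<tau> i))"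
      using sum_configs_exp[of "c * x" \<tau> N] by (simp add: mult_ac)
    also have "(\<Prod>i=1..N. cosh (c * x * \<tau> i)) \<le> (\<Prod>i=1..N. exp ((c * x)\<^sup>2 / 2))"
    proof (intro prod_mono conjI)
      fix i assume "i \<in> {1..N}"
      then have "(c * x * \<tau> i)\<^sup>2 = (c * x)\<^sup>2" using \<tau>[of i] by auto
      then show "cosh (c * x * \<tau> i) \<le> exp ((c * x)\<^sup>2 / 2)"
        using cosh_le_exp_half_square[of "c * x * \<tau> i"] by simp
    qed auto
    also have "\<dots> = exp (real N * (c * x)\<^sup>2 / 2)"
      by (simp add: exp_of_nat_mult[symmetric])
    also have "\<dots> \<le> exp (a * x\<^sup>2 / 2)"
      using a by (cases "N = 0") (auto simp: power_mult_distrib c2)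
    finally have "(\<Sum>\<sigma>\<in>configs N. exp (c * (\<Sum>i=1..N. \<tau> i * \<sigma> i) * x)) \<le> 2 ^ N * exp (a * x\<^sup>2 / 2)"
      by simp
    from mult_left_mono[OF this, of "std_normal_density x"]
    show "(\<Sum>\<sigma>\<in>configs N. std_normal_density x * exp (c * (\<Sum>i=1..N. \<tau> i * \<sigma> i) * x))
        \<le> 2 ^ N * (std_normal_density x * exp (a * x\<^sup>2 / 2))"
      by (simp add: sum_distrib_left mult_ac)
  qed (use hs has_bochner_integral_std_normal_exp_square[OF a(2)] in \<open>auto simp: has_bochner_integral_iff\<close>)
  also have "\<dots> = 2 ^ N / sqrt (1 - a)"
    using has_bochner_integral_std_normal_exp_square[OF a(2)] by (simp add: has_bochner_integral_iff)
  finally show ?thesis .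
qed

section \<open>The Curie-Weiss limit law\<close>

text \<open>
  The complex logarithm linearises the \<open>n\<close>-th power.  Caratheodory's form of the derivative
  of \<open>Ln\<close> at 1 avoids a separate treatment of the indices where \<open>a n = 0\<close>.
\<close>
lemma exp_eq_limit_power:
  fixes a :: "nat \<Rightarrow> complex"
  assumes "a \<longlonglongrightarrow> l"
  shows "(\<lambda>n. (1 + a n / of_nat n) ^ n) \<longlonglongrightarrow> exp l"
proof -
  have "((\<lambda>w. Ln (1 + w)) has_field_derivative 1) (at 0)"
    by (auto intro!: derivative_eq_intros)
  then obtain g where g: "\<And>w. Ln (1 + w) = g w * w" "isCont g 0" "g 0 = 1"
    unfolding CARAT_DERIV by auto
  have w: "(\<lambda>n. a n / of_nat n) \<longlonglongrightarrow> 0"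
    using tendsto_mult[OF assms lim_1_over_n] by simp
  have "(\<lambda>n. exp (a n * g (a n / of_nat n))) \<longlonglongrightarrow> exp (l * 1)"
    using isCont_tendsto_compose[OF g(2) w] g(3) assms by (intro tendsto_intros) auto
  moreover have "eventually (\<lambda>n. exp (a n * g (a n / of_nat n)) = (1 + a n / of_nat n) ^ n) sequentially"
    using tendstoD[OF w, of 1, simplified] eventually_gt_at_top[of 0]
  proof eventually_elim
    case (elim n)
    then have "1 + a n / of_nat n \<noteq> 0"
      by (metis add_eq_0_iff less_irrefl norm_minus_cancel norm_one)
    moreover have "a n * g (a n / of_nat n) = of_nat n * Ln (1 + a n / of_nat n)"
      using elim g(1)[of "a n / of_nat n"] by simp
    ultimately show ?case by (simp add: exp_of_nat_mult)
  qed
  ultimately show ?thesis by (simp add: tendsto_cong)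
qed

text \<open>
  The identity \<open>cosh (2 w) = 1 + 2 (sinh w)\<^sup>2\<close> turns the power of \<open>cosh\<close> into the form
  of the previous lemma.  This is the central limit theorem for fair signs, at a complex argument.
\<close>
lemma cosh_power_tendsto:
  fixes z :: "nat \<Rightarrow> complex"
  assumes "z \<longlonglongrightarrow> l"
  shows "(\<lambda>n. cosh (z n / of_real (sqrt (real n))) ^ n) \<longlonglongrightarrow> exp (l\<^sup>2 / 2)"
proof -
  have "(sinh has_field_derivative (1::complex)) (at 0)"
    by (auto intro!: derivative_eq_intros)
  then obtain g where g: "\<And>w::complex. sinh w = g w * w" "isCont g 0" "g 0 = 1"
    unfolding CARAT_DERIV by auto
  define w where "w n = z n / (2 * of_real (sqrt (real n)))" for n
  have "(\<lambda>n. 1 / sqrt (real n)) \<longlonglongrightarrow> 0"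
    by real_asymp
  from tendsto_mult[OF assms tendsto_of_real[OF this]]
  have "(\<lambda>n. z n / of_real (sqrt (real n)) / 2) \<longlonglongrightarrow> 0 / 2"
    by (intro tendsto_divide) auto
  then have w: "w \<longlonglongrightarrow> 0" by (simp add: w_def[abs_def] mult.commute)
  have "(\<lambda>n. (z n)\<^sup>2 / 2 * (g (w n))\<^sup>2) \<longlonglongrightarrow> l\<^sup>2 / 2 * 1\<^sup>2"
    using isCont_tendsto_compose[OF g(2) w] g(3) assms by (intro tendsto_intros) auto
  from exp_eq_limit_power[OF this]
  have "(\<lambda>n. (1 + ((z n)\<^sup>2 / 2 * (g (w n))\<^sup>2) / of_nat n) ^ n) \<longlonglongrightarrow> exp (l\<^sup>2 / 2)"
    by simp
  moreover have "(1 + ((z n)\<^sup>2 / 2 * (g (w n))\<^sup>2) / of_nat n) ^ n = cosh (z n / of_real (sqrt (real n))) ^ n" for n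
  proof (cases "n = 0")
    case False
    have "cosh (z n / of_real (sqrt (real n))) = cosh (2 * w n)"
      by (simp add: w_def)
    also have "\<dots> = 1 + 2 * (sinh (w n))\<^sup>2"
      by (simp add: cosh_double cosh_square_eq)
    also have "\<dots> = 1 + 2 * (g (w n))\<^sup>2 * (w n)\<^sup>2"
      by (simp add: g(1)[of "w n"] power_mult_distrib)
    also have "(w n)\<^sup>2 = (z n)\<^sup>2 / (4 * of_nat n)"
      by (simp add: w_def power_divide power_mult_distrib flip: of_real_power)
    finally have "cosh (z n / of_real (sqrt (real n))) = 1 + ((z n)\<^sup>2 / 2 * (g (w n))\<^sup>2) / of_nat n"
      by simp
    then show ?thesis by (simp only:)
  qed simp
  ultimately show ?thesis by simp
qed

lemma norm_cosh_le: "norm (cosh z) \<le> cosh (Re z)"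
proof -
  have "norm (cosh z) \<le> (norm (exp z) + norm (exp (- z))) / 2"
    unfolding cosh_field_def norm_divide using norm_triangle_ineq[of "exp z" "exp (- z)"] by simp
  then show ?thesis by (simp add: cosh_field_def)
qed

text \<open>
  As an image measure the law of the magnetization inherits the formula for integrals over a
  finite set.
\<close>
lemma magnetization_law_eq_distr:
  "magnetization_law N p \<beta> e =
    distr (point_measure (configs N) (\<lambda>\<sigma>. exp (- \<beta> * hamiltonian N p e \<sigma>) / partition_function N p \<beta> e))
      borel (\<lambda>\<sigma>. 1 / sqrt (real N) * (\<Sum>i=1..N. \<sigma> i))" (is "_ = distr ?P borel ?X")
proof (rule measure_eqI)
  fix A assume "A \<in> sets (magnetization_law N p \<beta> e)"
  then have A: "A \<in> sets borel" by simp
  have "emeasure (distr ?P borel ?X) A = emeasure ?P (?X -` A \<inter> configs N)"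
    using A by (subst emeasure_distr) (auto simp: space_point_measure measurable_def sets_point_measure)
  also have "\<dots> = (\<Sum>\<sigma>\<in>?X -` A \<inter> configs N. ennreal (exp (- \<beta> * hamiltonian N p e \<sigma>) / partition_function N p \<beta> e))"
    by (subst emeasure_point_measure_finite) auto
  also have "\<dots> = (\<Sum>\<sigma>\<in>configs N. ennreal (exp (- \<beta> * hamiltonian N p e \<sigma>) / partition_function N p \<beta> e) * indicator A (?X \<sigma>))"
    by (intro sum.mono_neutral_cong_left) (auto simp: indicator_def)
  also have "\<dots> = emeasure (magnetization_law N p \<beta> e) A"
    using A by (simp add: emeasure_magnetization_law)
  finally show "emeasure (magnetization_law N p \<beta> e) A = emeasure (distr ?P borel ?X) A" ..
qed simp

lemma integral_magnetization_law:
  fixes f :: "real \<Rightarrow> 'b :: {banach, second_countable_topology}"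
  assumes f: "f \<in> borel_measurable borel"
  shows "(\<integral>x. f x \<partial>magnetization_law N p \<beta> e) =
    (\<Sum>\<sigma>\<in>configs N. (exp (- \<beta> * hamiltonian N p e \<sigma>) / partition_function N p \<beta> e) *\<^sub>R
      f (1 / sqrt (real N) * (\<Sum>i=1..N. \<sigma> i)))"
  unfolding magnetization_law_eq_distr using partition_function_pos[of N p \<beta> e]
  by (subst integral_distr[OF _ f])
     (auto simp: lebesgue_integral_point_measure_finite measurable_def space_point_measure sets_point_measure less_imp_le)

text \<open>
  The Curie-Weiss model at inverse temperature \<open>b\<close> is the Ising model on the complete
  directed graph with loops, that is, with \<open>p = 1\<close> and every indicator equal to 1.
\<close>
definition curie_weiss_law :: "nat \<Rightarrow> real \<Rightarrow> real measure" where
  "curie_weiss_law N b = magnetization_law N 1 b (\<lambda>_ _. 1)"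

lemma hamiltonian_complete_graph:
  "- b * hamiltonian N 1 (\<lambda>_ _. 1) \<sigma> = b / (2 * real N) * (\<Sum>i=1..N. \<sigma> i)\<^sup>2"
  by (simp add: hamiltonian_def power2_eq_square sum_product)

text \<open>
  The unnormalised characteristic function of the Curie-Weiss magnetization, divided by
  \<open>2 ^ N\<close> and rewritten by the Hubbard-Stratonovich transform.
\<close>
definition cw_transform :: "nat \<Rightarrow> real \<Rightarrow> real \<Rightarrow> complex" where
  "cw_transform N b s = (\<integral>x. std_normal_density x *\<^sub>R
     cosh ((sqrt b * x + \<i> * s) / of_real (sqrt (real N))) ^ N \<partial>lborel)"

lemma curie_weiss_linearisation:
  assumes b: "0 \<le> b"
  shows "(\<Sum>\<sigma>\<in>configs N. exp (b / (2 * real N) * (\<Sum>i=1..N. \<sigma> i)\<^sup>2) *\<^sub>R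
      iexp (s * (1 / sqrt (real N) * (\<Sum>i=1..N. \<sigma> i)))) = 2 ^ N * cw_transform N b s"
proof -
  let ?X = "\<lambda>\<sigma>. 1 / sqrt (real N) * (\<Sum>i=1..N. \<sigma> i)"
  have *: "b / (2 * real N) * (\<Sum>i=1..N. \<sigma> i)\<^sup>2 = (sqrt b * ?X \<sigma>)\<^sup>2 / 2" for \<sigma>
    using b by (simp add: power_mult_distrib power_divide)
  have hs: "has_bochner_integral lborel
      (\<lambda>x. \<Sum>\<sigma>\<in>configs N. (std_normal_density x * exp (sqrt b * ?X \<sigma> * x)) *\<^sub>R iexp (s * ?X \<sigma>))
      (\<Sum>\<sigma>\<in>configs N. exp ((sqrt b * ?X \<sigma>)\<^sup>2 / 2) *\<^sub>R iexp (s * ?X \<sigma>))"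
    by (intro has_bochner_integral_sum has_bochner_integral_scaleR_left
        has_bochner_integral_std_normal_exp_linear)
  have lin: "(\<Sum>\<sigma>\<in>configs N. (std_normal_density x * exp (sqrt b * ?X \<sigma> * x)) *\<^sub>R iexp (s * ?X \<sigma>)) =
      2 ^ N * (std_normal_density x *\<^sub>R cosh ((sqrt b * x + \<i> * s) / of_real (sqrt (real N))) ^ N)"
    for x :: real
  proof -
    have "(std_normal_density x * exp (sqrt b * ?X \<sigma> * x)) *\<^sub>R iexp (s * ?X \<sigma>) =
       std_normal_density x *\<^sub>R exp ((sqrt b * x + \<i> * s) / of_real (sqrt (real N)) * of_real (\<Sum>i=1..N. 1 * \<sigma> i))" for \<sigma>
      by (simp add: scaleR_conv_of_real exp_of_real[symmetric] exp_add[symmetric] add_divide_distrib ring_distribs ac_simps del: of_real_sum)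
    then show ?thesis
      by (simp only: scaleR_sum_right[symmetric] sum_configs_exp) (simp add: mult_scaleR_right)
  qed
  show ?thesis
    using has_bochner_integral_integral_eq[OF hs, symmetric]
    by (simp only: lin * cw_transform_def integral_mult_right_zero)
qed

lemma char_curie_weiss_law:
  assumes b: "0 \<le> b"
  shows "char (curie_weiss_law N b) s = cw_transform N b s / cw_transform N b 0"
proof -
  let ?S = "\<lambda>\<sigma>. \<Sum>i=1..N. \<sigma> i"
  let ?w = "\<lambda>\<sigma>. exp (b / (2 * real N) * (?S \<sigma>)\<^sup>2)"
  have Z: "partition_function N 1 b (\<lambda>_ _. 1) = (\<Sum>\<sigma>\<in>configs N. ?w \<sigma>)"
    by (simp only: partition_function_def hamiltonian_complete_graph)
  have "of_real (\<Sum>\<sigma>\<in>configs N. ?w \<sigma>) = 2 ^ N * cw_transform N b 0"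
    using curie_weiss_linearisation[OF b, of N 0] by (simp add: scaleR_conv_of_real)
  moreover have "char (curie_weiss_law N b) s =
      (\<Sum>\<sigma>\<in>configs N. ?w \<sigma> *\<^sub>R iexp (s * (1 / sqrt (real N) * ?S \<sigma>))) / of_real (\<Sum>\<sigma>\<in>configs N. ?w \<sigma>)"
    unfolding char_def curie_weiss_law_def
    by (subst integral_magnetization_law)
       (simp_all only: hamiltonian_complete_graph Z, simp_all add: sum_divide_distrib scaleR_conv_of_real)
  ultimately show ?thesis
    by (simp only: curie_weiss_linearisation[OF b]) simp
qed

text \<open>
  Pointwise convergence of the integrand is \<open>cosh_power_tendsto\<close>; since \<open>r < 1\<close>, the
  function \<open>exp (r x\<^sup>2 / 2)\<close> is integrable against the standard normal density and dominates.
  In the limit the inverse temperature \<open>\<beta>\<close> flattens the Gaussian weight from variance 1 to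
  variance \<open>1 / (1 - \<beta>)\<close>, which is where the variance in the limit law comes from.
\<close>
lemma cw_transform_tendsto:
  assumes b: "b \<longlonglongrightarrow> \<beta>" and b0: "\<And>N. 0 \<le> b N" and br: "\<And>N. b N \<le> r" and r: "r < 1"
  shows "(\<lambda>N. cw_transform N (b N) s) \<longlonglongrightarrow>
    of_real (1 / sqrt (1 - \<beta>) * exp (- s\<^sup>2 / (2 * (1 - \<beta>))))"
proof -
  have "0 \<le> \<beta>" "\<beta> \<le> r"
    using LIMSEQ_le_const[OF b] LIMSEQ_le_const2[OF b] b0 br by auto
  then have \<beta>: "0 \<le> \<beta>" "\<beta> < 1" using r by auto
  have [measurable]: "cosh \<in> borel_measurable (borel :: complex measure)"
    by (intro borel_measurable_continuous_onI continuous_intros)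
  have "(\<lambda>N. cw_transform N (b N) s) \<longlonglongrightarrow>
      (\<integral>x. std_normal_density x *\<^sub>R exp ((of_real (sqrt \<beta> * x) + \<i> * of_real s)\<^sup>2 / 2) \<partial>lborel)"
    unfolding cw_transform_def
  proof (rule integral_dominated_convergence[where w = "\<lambda>x. std_normal_density x * exp (r * x\<^sup>2 / 2)"])
    show "integrable lborel (\<lambda>x. std_normal_density x * exp (r * x\<^sup>2 / 2))"
      using has_bochner_integral_std_normal_exp_square[OF r] by (simp add: has_bochner_integral_iff)
    show "AE x in lborel. (\<lambda>N. std_normal_density x *\<^sub>R
        cosh ((of_real (sqrt (b N) * x) + \<i> * of_real s) / of_real (sqrt (real N))) ^ N)
      \<longlonglongrightarrow> std_normal_density x *\<^sub>R exp ((of_real (sqrt \<beta> * x) + \<i> * of_real s)\<^sup>2 / 2)"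
      by (intro AE_I2 tendsto_scaleR tendsto_const cosh_power_tendsto tendsto_intros b)
    show "AE x in lborel. norm (std_normal_density x *\<^sub>R
        cosh ((of_real (sqrt (b N) * x) + \<i> * of_real s) / of_real (sqrt (real N))) ^ N)
      \<le> std_normal_density x * exp (r * x\<^sup>2 / 2)" for N
    proof (rule AE_I2)
      fix x
      let ?z = "(of_real (sqrt (b N) * x) + \<i> * of_real s) / of_real (sqrt (real N))"
      have "norm (cosh ?z) \<le> cosh (sqrt (b N) * x / sqrt (real N))"
        using norm_cosh_le[of ?z] by (simp add: Re_divide_of_real del: of_real_mult)
      also have "\<dots> \<le> exp ((sqrt (b N) * x / sqrt (real N))\<^sup>2 / 2)"
        by (rule cosh_le_exp_half_square)
      finally have "norm (cosh ?z ^ N) \<le> exp ((sqrt (b N) * x / sqrt (real N))\<^sup>2 / 2) ^ N"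
        unfolding norm_power by (intro power_mono) auto
      also have "\<dots> = exp (real N * ((sqrt (b N) * x / sqrt (real N))\<^sup>2 / 2))"
        by (simp only: exp_of_nat_mult)
      also have "\<dots> \<le> exp (r * x\<^sup>2 / 2)"
        using b0[of N] br[of N]
        by (cases "N = 0") (auto simp: power_mult_distrib power_divide intro!: mult_right_mono)
      finally show "norm (std_normal_density x *\<^sub>R cosh ?z ^ N) \<le> std_normal_density x * exp (r * x\<^sup>2 / 2)"
        by (simp add: mult_left_mono)
    qed
  qed simp_all
  also have "(\<integral>x. std_normal_density x *\<^sub>R exp ((of_real (sqrt \<beta> * x) + \<i> * of_real s)\<^sup>2 / 2) \<partial>lborel) =
      (\<integral>x. (exp (- s\<^sup>2 / 2) / sqrt (1 - \<beta>)) *\<^sub>R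
        (normal_density 0 (1 / sqrt (1 - \<beta>)) x *\<^sub>R iexp ((sqrt \<beta> * s) * x)) \<partial>lborel)"
  proof (intro Bochner_Integration.integral_cong refl)
    fix x
    have "(of_real (sqrt \<beta> * x) + \<i> * of_real s)\<^sup>2 / 2 =
        complex_of_real (\<beta> * x\<^sup>2 / 2) + complex_of_real (- s\<^sup>2 / 2) + \<i> * of_real (sqrt \<beta> * s * x)"
      using \<beta> by (simp add: power2_sum power_mult_distrib add_divide_distrib flip: of_real_power)
    then have "exp ((of_real (sqrt \<beta> * x) + \<i> * of_real s)\<^sup>2 / 2) =
        (exp (\<beta> * x\<^sup>2 / 2) * exp (- s\<^sup>2 / 2)) *\<^sub>R iexp (sqrt \<beta> * s * x)"
      by (simp only: exp_add exp_of_real scaleR_conv_of_real of_real_mult)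
    moreover have "std_normal_density x * (exp (\<beta> * x\<^sup>2 / 2) * exp (- s\<^sup>2 / 2)) =
        exp (- s\<^sup>2 / 2) / sqrt (1 - \<beta>) * normal_density 0 (1 / sqrt (1 - \<beta>)) x"
      by (subst mult.assoc[symmetric], subst std_normal_density_exp_square[OF \<beta>(2)]) simp
    ultimately show "std_normal_density x *\<^sub>R exp ((of_real (sqrt \<beta> * x) + \<i> * of_real s)\<^sup>2 / 2) =
        (exp (- s\<^sup>2 / 2) / sqrt (1 - \<beta>)) *\<^sub>R
          (normal_density 0 (1 / sqrt (1 - \<beta>)) x *\<^sub>R iexp ((sqrt \<beta> * s) * x))"
      by (simp only: scaleR_scaleR)
  qed
  also have "\<dots> = of_real (exp (- s\<^sup>2 / 2) / sqrt (1 - \<beta>) *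
      exp (- ((1 / sqrt (1 - \<beta>))\<^sup>2 * (sqrt \<beta> * s)\<^sup>2) / 2))"
    using \<beta> by (subst integral_scaleR_right, subst char_normal_density) (simp_all add: scaleR_conv_of_real)
  also have "exp (- s\<^sup>2 / 2) / sqrt (1 - \<beta>) * exp (- ((1 / sqrt (1 - \<beta>))\<^sup>2 * (sqrt \<beta> * s)\<^sup>2) / 2) =
      1 / sqrt (1 - \<beta>) * exp (- s\<^sup>2 / 2 + - ((1 / sqrt (1 - \<beta>))\<^sup>2 * (sqrt \<beta> * s)\<^sup>2) / 2)"
    by (simp only: exp_add) simp
  also have "- s\<^sup>2 / 2 + - ((1 / sqrt (1 - \<beta>))\<^sup>2 * (sqrt \<beta> * s)\<^sup>2) / 2 = - s\<^sup>2 / (2 * (1 - \<beta>))"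
    using \<beta> by (simp add: power_divide power_mult_distrib field_simps)
  finally show ?thesis .
qed

lemma char_normal_law:
  assumes "v > 0"
  shows "char (normal_law 0 v) s = of_real (exp (- (v * s\<^sup>2) / 2))"
  unfolding char_def normal_law_def
  using char_normal_density[of "sqrt v" s] assms by (subst integral_density) auto

lemma real_distribution_normal_law: "v > 0 \<Longrightarrow> real_distribution (normal_law m v)"
  using prob_space_normal_law[of v m]
  by (simp add: real_distribution_def real_distribution_axioms_def normal_law_def)

lemma real_distribution_curie_weiss_law: "real_distribution (curie_weiss_law N b)"
  using prob_space_magnetization_law
  by (simp add: real_distribution_def real_distribution_axioms_def curie_weiss_law_def)

lemma measure_normal_law_singleton: "measure (normal_law m v) {x} = 0"
  unfolding normal_law_def
  by (intro measure_eq_emeasure_eq_ennreal) (simp_all add: emeasure_density nn_integral_null_set)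

text \<open>
  By Levy's continuity theorem.  The inverse temperature may vary with \<open>N\<close> because averaging
  over the edges produces a Curie-Weiss model whose inverse temperature merely converges to \<open>\<beta>\<close>.  Truncating it at
  some \<open>r < 1\<close> changes finitely many terms and makes the domination uniform in \<open>N\<close>.
\<close>
lemma curie_weiss_law_cdf_tendsto:
  assumes b: "b \<longlonglongrightarrow> \<beta>" and b0: "\<And>N. 0 \<le> b N" and \<beta>: "\<beta> < 1"
  shows "(\<lambda>N. measure (curie_weiss_law N (b N)) {..t}) \<longlonglongrightarrow> measure (normal_law 0 (1 / (1 - \<beta>))) {..t}"
proof -
  define r where "r = (1 + \<beta>) / 2"
  have r: "r < 1" "\<beta> < r" using \<beta> by (auto simp: r_def)
  define c where "c N = min (b N) r" for N
  have "0 \<le> \<beta>" using LIMSEQ_le_const[OF b] b0 by auto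
  then have c0: "0 \<le> c N" "c N \<le> r" for N using b0[of N] r by (auto simp: c_def)
  have "c \<longlonglongrightarrow> min \<beta> r" unfolding c_def by (intro tendsto_intros b)
  then have c: "c \<longlonglongrightarrow> \<beta>" using r by simp
  have "weak_conv_m (\<lambda>N. curie_weiss_law N (c N)) (normal_law 0 (1 / (1 - \<beta>)))"
  proof (rule levy_continuity)
    fix s
    have "(\<lambda>N. cw_transform N (c N) s / cw_transform N (c N) 0) \<longlonglongrightarrow>
        of_real (1 / sqrt (1 - \<beta>) * exp (- s\<^sup>2 / (2 * (1 - \<beta>)))) /
        of_real (1 / sqrt (1 - \<beta>) * exp (- 0\<^sup>2 / (2 * (1 - \<beta>))))"
      using \<beta> by (intro tendsto_divide cw_transform_tendsto[OF c c0 r(1)]) simp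
    then show "(\<lambda>N. char (curie_weiss_law N (c N)) s) \<longlonglongrightarrow> char (normal_law 0 (1 / (1 - \<beta>))) s"
      using \<beta> by (simp add: char_curie_weiss_law[OF c0(1)] char_normal_law mult.commute)
  qed (use \<beta> in \<open>auto intro: real_distribution_normal_law real_distribution_curie_weiss_law\<close>)
  moreover interpret real_distribution "normal_law 0 (1 / (1 - \<beta>))"
    using \<beta> by (intro real_distribution_normal_law) simp
  have "isCont (cdf (normal_law 0 (1 / (1 - \<beta>)))) t"
    by (simp add: isCont_cdf measure_normal_law_singleton)
  ultimately have "(\<lambda>N. measure (curie_weiss_law N (c N)) {..t}) \<longlonglongrightarrow> measure (normal_law 0 (1 / (1 - \<beta>))) {..t}"
    by (simp add: weak_conv_m_def weak_conv_def cdf_def)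
  moreover have "eventually (\<lambda>N. c N = b N) sequentially"
    using order_tendstoD(2)[OF b r(2)] by eventually_elim (simp add: c_def)
  ultimately show ?thesis by (auto elim!: Lim_transform_eventually elim: eventually_mono)
qed

section \<open>Averages over the random edges\<close>

text \<open>
  For \<open>\<epsilon> \<in> {0, 1}\<close> and \<open>x = \<plusminus>1\<close> one has
  \<open>exp (\<gamma> \<epsilon> x) = (cosh \<gamma>) ^ \<epsilon> * (1 + tanh \<gamma> * \<epsilon> * x)\<close>.  The \<open>cosh\<close> factor depends
  on the graph only, so it cancels in the Gibbs measure, and what remains of the Boltzmann weight is
  the product below with \<open>t = tanh \<gamma>\<close>.  Each factor is affine in its edge indicator, so
  expectations over the edges factorise and just replace indicators by probabilities.
\<close>
definition edge_weight :: "nat \<Rightarrow> real \<Rightarrow> (nat \<Rightarrow> nat \<Rightarrow> real) \<Rightarrow> (nat \<Rightarrow> real) \<Rightarrow> real" where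
  "edge_weight N t d \<sigma> = (\<Prod>k\<in>{1..N} \<times> {1..N}. 1 + t * d (fst k) (snd k) * (\<sigma> (fst k) * \<sigma> (snd k)))"

lemma sum_sum_eq_sum_times:
  "(\<Sum>i=1..N. \<Sum>j=1..N. f i j) = (\<Sum>k\<in>{1..N::nat} \<times> {1..N::nat}. f (fst k) (snd k) :: real)"
  by (simp add: sum.cartesian_product case_prod_unfold)

lemma sum_edges_square: "(\<Sum>k\<in>{1..N::nat} \<times> {1..N}. f (fst k) * f (snd k) :: real) = (\<Sum>i=1..N. f i)\<^sup>2"
  by (simp add: power2_eq_square sum_product sum.cartesian_product case_prod_unfold)

lemma configs_edge_sign:
  assumes "\<sigma> \<in> configs N" "k \<in> {1..N} \<times> {1..N}"
  shows "\<sigma> (fst k) * \<sigma> (snd k) = 1 \<or> \<sigma> (fst k) * \<sigma> (snd k) = -1"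
  using assms configs_sign[of \<sigma> N "fst k"] configs_sign[of \<sigma> N "snd k"] by auto

lemma edge_weight_pos:
  assumes "\<sigma> \<in> configs N" "0 \<le> t" "t < 1"
    and d: "\<And>i j. i \<in> {1..N} \<Longrightarrow> j \<in> {1..N} \<Longrightarrow> 0 \<le> d i j \<and> d i j \<le> 1"
  shows "0 < edge_weight N t d \<sigma>"
  unfolding edge_weight_def
proof (rule prod_pos)
  fix k assume k: "k \<in> {1..N} \<times> {1..N}"
  have dk: "0 \<le> d (fst k) (snd k)" "d (fst k) (snd k) \<le> 1"
    using d[of "fst k" "snd k"] k by auto
  have c: "0 \<le> t * d (fst k) (snd k)" "t * d (fst k) (snd k) < 1"
    using dk assms(2,3) mult_left_mono[OF dk(2) assms(2)] by auto
  have pos: "0 < 1 + c * x" if "x = 1 \<or> x = -1" "0 \<le> c" "c < 1" for c x :: real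
    using that by auto
  show "0 < 1 + t * d (fst k) (snd k) * (\<sigma> (fst k) * \<sigma> (snd k))"
    by (rule pos[OF configs_edge_sign[OF assms(1) k] c])
qed

lemma exp_times_sign: "x = 1 \<or> x = -1 \<Longrightarrow> exp (g * x) = cosh g * (1 + tanh g * x)" for x g :: real
  by (auto simp: tanh_def ring_distribs cosh_plus_sinh cosh_minus_sinh)

lemma boltzmann_weight_eq_edge_weight:
  assumes "\<sigma> \<in> configs N"
    and e: "\<And>i j. i \<in> {1..N} \<Longrightarrow> j \<in> {1..N} \<Longrightarrow> e i j = 0 \<or> e i j = 1"
  shows "exp (- \<beta> * hamiltonian N p e \<sigma>) =
    (\<Prod>k\<in>{1..N} \<times> {1..N}. cosh (\<beta> / (2 * real N * p) * e (fst k) (snd k))) *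
      edge_weight N (tanh (\<beta> / (2 * real N * p))) e \<sigma>"
proof -
  define g where "g = \<beta> / (2 * real N * p)"
  have "- \<beta> * hamiltonian N p e \<sigma> = g * (\<Sum>i=1..N. \<Sum>j=1..N. e i j * \<sigma> i * \<sigma> j)"
    by (simp add: hamiltonian_def g_def)
  also have "\<dots> = (\<Sum>k\<in>{1..N} \<times> {1..N}. g * e (fst k) (snd k) * (\<sigma> (fst k) * \<sigma> (snd k)))"
    by (simp only: sum_sum_eq_sum_times sum_distrib_left mult.assoc)
  finally have "exp (- \<beta> * hamiltonian N p e \<sigma>) =
      (\<Prod>k\<in>{1..N} \<times> {1..N}. exp (g * e (fst k) (snd k) * (\<sigma> (fst k) * \<sigma> (snd k))))"
    by (simp add: exp_sum)
  also have "\<dots> = (\<Prod>k\<in>{1..N} \<times> {1..N}. cosh (g * e (fst k) (snd k)) *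
      (1 + tanh g * e (fst k) (snd k) * (\<sigma> (fst k) * \<sigma> (snd k))))"
  proof (rule prod.cong[OF refl])
    fix k assume k: "k \<in> {1..N} \<times> {1..N}"
    show "exp (g * e (fst k) (snd k) * (\<sigma> (fst k) * \<sigma> (snd k))) = cosh (g * e (fst k) (snd k)) *
      (1 + tanh g * e (fst k) (snd k) * (\<sigma> (fst k) * \<sigma> (snd k)))"
      using e[of "fst k" "snd k"] k exp_times_sign[OF configs_edge_sign[OF assms(1) k], of g] by auto
  qed
  finally show ?thesis by (simp add: prod.distrib edge_weight_def g_def)
qed

definition configs_in :: "nat \<Rightarrow> real set \<Rightarrow> (nat \<Rightarrow> real) set" where
  "configs_in N A = {\<sigma> \<in> configs N. 1 / sqrt (real N) * (\<Sum>i=1..N. \<sigma> i) \<in> A}"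

lemma measure_magnetization_law_proportional:
  assumes A: "A \<in> sets borel" and "C > 0"
    and w: "\<And>\<sigma>. \<sigma> \<in> configs N \<Longrightarrow> exp (- \<beta> * hamiltonian N p e \<sigma>) = C * w \<sigma>"
  shows "measure (magnetization_law N p \<beta> e) A =
    (\<Sum>\<sigma>\<in>configs_in N A. w \<sigma>) / (\<Sum>\<sigma>\<in>configs N. w \<sigma>)"
proof -
  have "partition_function N p \<beta> e = C * (\<Sum>\<sigma>\<in>configs N. w \<sigma>)"
    unfolding partition_function_def sum_distrib_left by (intro sum.cong w refl)
  moreover have "measure (magnetization_law N p \<beta> e) A =
    (\<Sum>\<sigma>\<in>configs_in N A. C * w \<sigma>) / partition_function N p \<beta> e"
    unfolding measure_magnetization_law[OF A] sum_divide_distrib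
    by (intro sum.mono_neutral_cong_right) (auto simp: w[symmetric] indicator_def configs_in_def)
  moreover have "C * a / (C * b) = a / b" for a b using \<open>C > 0\<close> by simp
  ultimately show ?thesis by (simp only: sum_distrib_left[symmetric])
qed

lemma measure_magnetization_law_edge_weight:
  assumes A: "A \<in> sets borel"
    and e: "\<And>i j. i \<in> {1..N} \<Longrightarrow> j \<in> {1..N} \<Longrightarrow> e i j = 0 \<or> e i j = 1"
  shows "measure (magnetization_law N p \<beta> e) A =
    (\<Sum>\<sigma>\<in>configs_in N A. edge_weight N (tanh (\<beta> / (2 * real N * p))) e \<sigma>) /
    (\<Sum>\<sigma>\<in>configs N. edge_weight N (tanh (\<beta> / (2 * real N * p))) e \<sigma>)"
proof (rule measure_magnetization_law_proportional[OF A])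
  show "0 < (\<Prod>k\<in>{1..N} \<times> {1..N}. cosh (\<beta> / (2 * real N * p) * e (fst k) (snd k)))"
    by (intro prod_pos) simp
qed (rule boltzmann_weight_eq_edge_weight[OF _ e])

text \<open>
  The inverse of the step from \<open>exp\<close> to \<open>1 + tanh\<close>: it turns the averaged product weight
  back into a Curie-Weiss weight.
\<close>
lemma one_plus_times_sign:
  fixes u x :: real
  assumes u: "\<bar>u\<bar> < 1" and x: "x = 1 \<or> x = -1"
  shows "1 + u * x = sqrt (1 - u\<^sup>2) * exp (artanh u * x)"
proof -
  have eq: "1 - u\<^sup>2 = (1 - u) * (1 + u)" by (simp add: power2_eq_square algebra_simps)
  have "exp (artanh u) = sqrt ((1 + u) / (1 - u))"
    using u unfolding artanh_def by (subst ln_sqrt[symmetric]) auto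
  then show ?thesis
    using x u unfolding eq
    by (auto simp: exp_minus real_sqrt_mult real_sqrt_divide abs_less_iff)
qed

text \<open>
  The spin products \<open>\<sigma> i * \<sigma> j\<close> along the edges add up to the squared magnetization, so
  averaging over the edges gives, up to a constant, the Curie-Weiss weight at inverse temperature
  \<open>2 * N * artanh (t * p)\<close>.
\<close>
lemma edge_weight_const:
  assumes \<sigma>: "\<sigma> \<in> configs N" and u: "\<bar>t * p\<bar> < 1"
  shows "edge_weight N t (\<lambda>_ _. p) \<sigma> =
    sqrt (1 - (t * p)\<^sup>2) ^ (N * N) * exp (artanh (t * p) * (\<Sum>i=1..N. \<sigma> i)\<^sup>2)"
proof -
  have "edge_weight N t (\<lambda>_ _. p) \<sigma> =
      (\<Prod>k\<in>{1..N} \<times> {1..N}. sqrt (1 - (t * p)\<^sup>2) * exp (artanh (t * p) * (\<sigma> (fst k) * \<sigma> (snd k))))"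
    unfolding edge_weight_def
    by (intro prod.cong refl one_plus_times_sign[OF u] configs_edge_sign[OF \<sigma>])
  also have "\<dots> = sqrt (1 - (t * p)\<^sup>2) ^ (N * N) *
      exp (\<Sum>k\<in>{1..N} \<times> {1..N}. artanh (t * p) * (\<sigma> (fst k) * \<sigma> (snd k)))"
    by (simp add: prod.distrib exp_sum card_cartesian_product)
  finally show ?thesis by (simp only: sum_distrib_left[symmetric] sum_edges_square)
qed

text \<open>
  The left-hand side is the mean over one edge of the product of the factors of two configurations,
  \<open>x\<close> and \<open>y\<close> being the two spin products along the edge; the first two factors on the
  right are the separate means.  The left-hand side divided by these means is
  \<open>1 + z\<close>, where \<open>z\<close> is the exponent, because
  \<open>1 / (1 + u x) = (1 - u x) / (1 - u\<^sup>2)\<close> for signs \<open>x\<close>.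
\<close>
lemma edge_pair_weight_le:
  fixes x y :: real
  assumes x: "x = 1 \<or> x = -1" and y: "y = 1 \<or> y = -1"
    and t: "0 \<le> t" "t < 1" and p: "0 \<le> p" "p \<le> 1"
  shows "1 + (t * x + t * y + t\<^sup>2 * (x * y)) * p \<le> (1 + t * p * x) * (1 + t * p * y) *
    exp (t\<^sup>2 * p * (1 - p) / (1 - (t * p)\<^sup>2)\<^sup>2 * (x * y - t * p * (x + y) + (t * p)\<^sup>2))"
proof -
  define u where "u = t * p"
  have u: "0 \<le> u" "u < 1" using t p mult_left_mono[of p 1 t] by (auto simp: u_def)
  then have "u\<^sup>2 < 1" by (simp add: abs_square_less_1)
  define v where "v = t\<^sup>2 * p * (1 - p)"
  have pos: "0 < (1 + u * x) * (1 + u * y)" using x y u by auto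
  have inv: "(1 + u * x) * (1 + u * y) * (x * y - u * (x + y) + u\<^sup>2) = (1 - u\<^sup>2)\<^sup>2 * (x * y)"
    using x y by (auto simp: power2_eq_square algebra_simps)
  have "1 + (t * x + t * y + t\<^sup>2 * (x * y)) * p = (1 + u * x) * (1 + u * y) + v * (x * y)"
    by (simp add: u_def v_def power2_eq_square algebra_simps)
  also have "v * (x * y) = v / (1 - u\<^sup>2)\<^sup>2 * ((1 - u\<^sup>2)\<^sup>2 * (x * y))"
    using \<open>u\<^sup>2 < 1\<close> by simp
  also have "\<dots> = (1 + u * x) * (1 + u * y) * (v / (1 - u\<^sup>2)\<^sup>2 * (x * y - u * (x + y) + u\<^sup>2))"
    unfolding inv[symmetric] by (simp only: mult_ac)
  also have "(1 + u * x) * (1 + u * y) + \<dots> = (1 + u * x) * (1 + u * y) *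
      (1 + v / (1 - u\<^sup>2)\<^sup>2 * (x * y - u * (x + y) + u\<^sup>2))"
    by (simp add: ring_distribs)
  also have "\<dots> \<le> (1 + u * x) * (1 + u * y) * exp (v / (1 - u\<^sup>2)\<^sup>2 * (x * y - u * (x + y) + u\<^sup>2))"
    using pos by (intro mult_left_mono exp_ge_add_one_self) auto
  finally show ?thesis by (simp only: u_def v_def)
qed

lemma measure_curie_weiss_law:
  assumes A: "A \<in> sets borel" and N: "N \<ge> 1" and u: "\<bar>t * p\<bar> < 1"
  shows "measure (curie_weiss_law N (2 * real N * artanh (t * p))) A =
    (\<Sum>\<sigma>\<in>configs_in N A. edge_weight N t (\<lambda>_ _. p) \<sigma>) / (\<Sum>\<sigma>\<in>configs N. edge_weight N t (\<lambda>_ _. p) \<sigma>)"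
  unfolding curie_weiss_law_def
proof (rule measure_magnetization_law_proportional[OF A])
  have u2: "(t * p)\<^sup>2 < 1" using u by (simp add: abs_square_less_1)
  then show "0 < 1 / sqrt (1 - (t * p)\<^sup>2) ^ (N * N)" by simp
  show "exp (- (2 * real N * artanh (t * p)) * hamiltonian N 1 (\<lambda>_ _. 1) \<sigma>) =
      1 / sqrt (1 - (t * p)\<^sup>2) ^ (N * N) * edge_weight N t (\<lambda>_ _. p) \<sigma>" if "\<sigma> \<in> configs N" for \<sigma>
    using N u2 by (simp only: hamiltonian_complete_graph edge_weight_const[OF that u]) simp
qed

context prob_space
begin

lemma
  fixes X :: "'i \<Rightarrow> 'a \<Rightarrow> real"
  assumes fin: "finite I" and indep: "indep_vars (\<lambda>_. borel) X I"
    and p: "\<And>k. k \<in> I \<Longrightarrow> prob {\<omega> \<in> space M. X k \<omega> = 1} = p"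
  shows integrable_prod_indicator: "integrable M (\<lambda>\<omega>. \<Prod>k\<in>I. 1 + a k * indicator {1} (X k \<omega>))"
    and expectation_prod_indicator:
      "expectation (\<lambda>\<omega>. \<Prod>k\<in>I. 1 + a k * indicator {1} (X k \<omega>)) = (\<Prod>k\<in>I. 1 + a k * p)"
proof -
  have X[measurable]: "X k \<in> borel_measurable M" if "k \<in> I" for k
    using indep that by (auto simp: indep_vars_def2)
  have ind: "indep_vars (\<lambda>_. borel) (\<lambda>k \<omega>. 1 + a k * indicator {1} (X k \<omega>)) I"
    by (rule indep_vars_compose2[OF indep]) measurable
  have int: "integrable M (\<lambda>\<omega>. indicator {1} (X k \<omega>) :: real)" if "k \<in> I" for k
    using that by (intro integrable_const_bound[of _ 1]) (auto simp: indicator_def)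
  have int': "integrable M (\<lambda>\<omega>. 1 + a k * indicator {1} (X k \<omega>))" if "k \<in> I" for k
    using int[OF that] by simp
  show "integrable M (\<lambda>\<omega>. \<Prod>k\<in>I. 1 + a k * indicator {1} (X k \<omega>))"
    by (rule indep_vars_integrable[OF fin ind int'])
  have "expectation (\<lambda>\<omega>. 1 + a k * indicator {1} (X k \<omega>)) = 1 + a k * p" if k: "k \<in> I" for k
  proof -
    have "expectation (\<lambda>\<omega>. indicator {1} (X k \<omega>)) = expectation (indicator {\<omega> \<in> space M. X k \<omega> = 1})"
      by (intro Bochner_Integration.integral_cong) (auto simp: indicator_def)
    also have "\<dots> = p" using p[OF k] X[OF k] by (simp add: Int_absorb2)
    finally show ?thesis using int[OF k] by (simp add: prob_space)
  qed
  then show "expectation (\<lambda>\<omega>. \<Prod>k\<in>I. 1 + a k * indicator {1} (X k \<omega>)) = (\<Prod>k\<in>I. 1 + a k * p)"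
    by (simp add: indep_vars_lebesgue_integral[OF fin ind int'])
qed

end

text \<open>
  The randomness at one fixed size \<open>N\<close>.  The indicators take the values 0 and 1 only almost
  surely; \<open>edge\<close> is a version of them that does so everywhere.
\<close>
locale random_edges = prob_space +
  fixes N :: nat and p :: real and e :: "nat \<Rightarrow> nat \<Rightarrow> 'a \<Rightarrow> real"
  assumes p: "0 \<le> p" "p \<le> 1"
    and indep: "indep_vars (\<lambda>_. borel) (\<lambda>(i, j). e i j) ({1..N} \<times> {1..N})"
    and prob_1: "\<And>i j. i \<in> {1..N} \<Longrightarrow> j \<in> {1..N} \<Longrightarrow> prob {\<omega> \<in> space M. e i j \<omega> = 1} = p"
    and prob_0: "\<And>i j. i \<in> {1..N} \<Longrightarrow> j \<in> {1..N} \<Longrightarrow> prob {\<omega> \<in> space M. e i j \<omega> = 0} = 1 - p"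
begin

abbreviation edge :: "'a \<Rightarrow> nat \<Rightarrow> nat \<Rightarrow> real" where
  "edge \<omega> i j \<equiv> indicator {1} (e i j \<omega>)"

lemma measurable_e: "i \<in> {1..N} \<Longrightarrow> j \<in> {1..N} \<Longrightarrow> e i j \<in> borel_measurable M"
  using indep by (auto simp: indep_vars_def2)

lemma AE_edge: "AE \<omega> in M. \<forall>i\<in>{1..N}. \<forall>j\<in>{1..N}. e i j \<omega> = 0 \<or> e i j \<omega> = 1"
proof (intro AE_finite_allI)
  fix i j assume ij: "i \<in> {1..N}" "j \<in> {1..N}"
  note [measurable] = measurable_e[OF ij]
  have "prob ({\<omega> \<in> space M. e i j \<omega> = 0} \<union> {\<omega> \<in> space M. e i j \<omega> = 1}) = 1"
    by (subst finite_measure_Union) (auto simp: prob_0[OF ij] prob_1[OF ij])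
  then have "AE \<omega> in M. \<omega> \<in> {\<omega> \<in> space M. e i j \<omega> = 0} \<union> {\<omega> \<in> space M. e i j \<omega> = 1}"
    by (subst (asm) prob_eq_1) auto
  then show "AE \<omega> in M. e i j \<omega> = 0 \<or> e i j \<omega> = 1" by auto
qed auto

lemma
  shows integrable_prod_edges: "integrable M (\<lambda>\<omega>. \<Prod>k\<in>{1..N} \<times> {1..N}. 1 + a k * edge \<omega> (fst k) (snd k))"
    and expectation_prod_edges: "expectation (\<lambda>\<omega>. \<Prod>k\<in>{1..N} \<times> {1..N}. 1 + a k * edge \<omega> (fst k) (snd k)) =
      (\<Prod>k\<in>{1..N} \<times> {1..N}. 1 + a k * p)"
  using integrable_prod_indicator[OF _ indep, of p a] expectation_prod_indicator[OF _ indep, of p a]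
  by (auto simp: prob_1 case_prod_unfold)

lemma
  shows integrable_edge_weight: "integrable M (\<lambda>\<omega>. edge_weight N t (edge \<omega>) \<sigma>)"
    and expectation_edge_weight:
      "expectation (\<lambda>\<omega>. edge_weight N t (edge \<omega>) \<sigma>) = edge_weight N t (\<lambda>_ _. p) \<sigma>"
proof -
  have eq: "edge_weight N t d \<sigma> =
      (\<Prod>k\<in>{1..N} \<times> {1..N}. 1 + t * (\<sigma> (fst k) * \<sigma> (snd k)) * d (fst k) (snd k))" for d
    unfolding edge_weight_def by (intro prod.cong refl) simp
  show "integrable M (\<lambda>\<omega>. edge_weight N t (edge \<omega>) \<sigma>)"
    "expectation (\<lambda>\<omega>. edge_weight N t (edge \<omega>) \<sigma>) = edge_weight N t (\<lambda>_ _. p) \<sigma>"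
    unfolding eq by (rule integrable_prod_edges expectation_prod_edges)+
qed

text \<open>
  Summing \<open>edge_pair_weight_le\<close> over the edges, the spin products \<open>x y\<close> add up to the
  square of the overlap of \<open>\<sigma>\<close> and \<open>\<tau>\<close>.  The terms linear in \<open>x\<close> and \<open>y\<close> add up to
  squared magnetizations with a negative sign and are dropped.
\<close>
lemma
  assumes \<sigma>: "\<sigma> \<in> configs N" and \<tau>: "\<tau> \<in> configs N" and t: "0 \<le> t" "t < 1"
  shows integrable_edge_weight_mult:
      "integrable M (\<lambda>\<omega>. edge_weight N t (edge \<omega>) \<sigma> * edge_weight N t (edge \<omega>) \<tau>)"
    and expectation_edge_weight_mult_le:
      "expectation (\<lambda>\<omega>. edge_weight N t (edge \<omega>) \<sigma> * edge_weight N t (edge \<omega>) \<tau>) \<le>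
        edge_weight N t (\<lambda>_ _. p) \<sigma> * edge_weight N t (\<lambda>_ _. p) \<tau> *
        exp (t\<^sup>2 * p / (1 - (t * p)\<^sup>2)\<^sup>2 * ((\<Sum>i=1..N. \<sigma> i * \<tau> i)\<^sup>2 + (real N * t * p)\<^sup>2))"
proof -
  let ?E = "{1..N} \<times> {1..N}"
  define x where "x k = \<sigma> (fst k) * \<sigma> (snd k)" for k
  define y where "y k = \<tau> (fst k) * \<tau> (snd k)" for k
  have sg: "x k = 1 \<or> x k = -1" "y k = 1 \<or> y k = -1" if "k \<in> ?E" for k
    using configs_edge_sign[OF \<sigma> that] configs_edge_sign[OF \<tau> that] by (auto simp: x_def y_def)
  define a where "a k = t * x k + t * y k + t\<^sup>2 * (x k * y k)" for k
  define K where "K = t\<^sup>2 * p * (1 - p) / (1 - (t * p)\<^sup>2)\<^sup>2"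
  have eq: "edge_weight N t (edge \<omega>) \<sigma> * edge_weight N t (edge \<omega>) \<tau> =
      (\<Prod>k\<in>?E. 1 + a k * edge \<omega> (fst k) (snd k))" for \<omega>
    unfolding edge_weight_def prod.distrib[symmetric] a_def x_def y_def
    by (intro prod.cong) (auto simp: indicator_def power2_eq_square algebra_simps)
  show "integrable M (\<lambda>\<omega>. edge_weight N t (edge \<omega>) \<sigma> * edge_weight N t (edge \<omega>) \<tau>)"
    unfolding eq by (rule integrable_prod_edges)
  have "expectation (\<lambda>\<omega>. edge_weight N t (edge \<omega>) \<sigma> * edge_weight N t (edge \<omega>) \<tau>) = (\<Prod>k\<in>?E. 1 + a k * p)"
    unfolding eq by (rule expectation_prod_edges)
  also have "\<dots> \<le> (\<Prod>k\<in>?E. (1 + t * p * x k) * (1 + t * p * y k) *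
      exp (K * (x k * y k - t * p * (x k + y k) + (t * p)\<^sup>2)))"
  proof (rule prod_mono, rule conjI)
    fix k assume k: "k \<in> ?E"
    \<comment> \<open>Nonnegativity of the factors: \<open>1 + a k\<close> is the product of the two edge factors when the
      edge is present, and \<open>1 + a k * p\<close> interpolates between 1 and it.\<close>
    have "0 \<le> (1 + t * x k) * (1 + t * y k)" using sg[OF k] t by auto
    then have "-1 \<le> a k" by (simp add: a_def power2_eq_square algebra_simps)
    then have "- p \<le> a k * p" using p mult_right_mono[of "-1" "a k" p] by simp
    then show "0 \<le> 1 + a k * p" using p by simp
    show "1 + a k * p \<le> (1 + t * p * x k) * (1 + t * p * y k) *
      exp (K * (x k * y k - t * p * (x k + y k) + (t * p)\<^sup>2))"
      unfolding a_def K_def by (rule edge_pair_weight_le[OF sg[OF k] t p])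
  qed
  also have "\<dots> = edge_weight N t (\<lambda>_ _. p) \<sigma> * edge_weight N t (\<lambda>_ _. p) \<tau> *
      exp (\<Sum>k\<in>?E. K * (x k * y k - t * p * (x k + y k) + (t * p)\<^sup>2))"
    by (simp add: prod.distrib exp_sum edge_weight_def x_def y_def)
  also have "(\<Sum>k\<in>?E. K * (x k * y k - t * p * (x k + y k) + (t * p)\<^sup>2)) =
      K * ((\<Sum>k\<in>?E. x k * y k) - t * p * ((\<Sum>k\<in>?E. x k) + (\<Sum>k\<in>?E. y k)) + real N * real N * (t * p)\<^sup>2)"
    by (simp only: sum_distrib_left[symmetric] sum.distrib sum_subtractf sum_constant card_cartesian_product)
       simp
  also have "(\<Sum>k\<in>?E. x k) = (\<Sum>i=1..N. \<sigma> i)\<^sup>2"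
    unfolding x_def by (rule sum_edges_square)
  also have "(\<Sum>k\<in>?E. y k) = (\<Sum>i=1..N. \<tau> i)\<^sup>2"
    unfolding y_def by (rule sum_edges_square)
  also have "(\<Sum>k\<in>?E. x k * y k) = (\<Sum>k\<in>?E. (\<sigma> (fst k) * \<tau> (fst k)) * (\<sigma> (snd k) * \<tau> (snd k)))"
    unfolding x_def y_def by (simp only: mult_ac)
  also have "\<dots> = (\<Sum>i=1..N. \<sigma> i * \<tau> i)\<^sup>2"
    by (rule sum_edges_square)
  also have "real N * real N * (t * p)\<^sup>2 = (real N * t * p)\<^sup>2"
    by (simp add: power2_eq_square)
  also have "K * ((\<Sum>i=1..N. \<sigma> i * \<tau> i)\<^sup>2 - t * p * ((\<Sum>i=1..N. \<sigma> i)\<^sup>2 + (\<Sum>i=1..N. \<tau> i)\<^sup>2)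
      + (real N * t * p)\<^sup>2) \<le> K * ((\<Sum>i=1..N. \<sigma> i * \<tau> i)\<^sup>2 + (real N * t * p)\<^sup>2)"
    using t p by (intro mult_left_mono) (auto simp: K_def)
  also have "\<dots> \<le> t\<^sup>2 * p / (1 - (t * p)\<^sup>2)\<^sup>2 * ((\<Sum>i=1..N. \<sigma> i * \<tau> i)\<^sup>2 + (real N * t * p)\<^sup>2)"
    unfolding K_def using p mult_left_mono[of "1 - p" 1 "t\<^sup>2 * p"]
    by (intro mult_right_mono divide_right_mono) auto
  finally show "expectation (\<lambda>\<omega>. edge_weight N t (edge \<omega>) \<sigma> * edge_weight N t (edge \<omega>) \<tau>) \<le>
        edge_weight N t (\<lambda>_ _. p) \<sigma> * edge_weight N t (\<lambda>_ _. p) \<tau> *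
        exp (t\<^sup>2 * p / (1 - (t * p)\<^sup>2)\<^sup>2 * ((\<Sum>i=1..N. \<sigma> i * \<tau> i)\<^sup>2 + (real N * t * p)\<^sup>2))"
    using edge_weight_pos[OF \<sigma> t, of "\<lambda>_ _. p"] edge_weight_pos[OF \<tau> t, of "\<lambda>_ _. p"] p
    by (auto elim!: order_trans intro!: mult_left_mono)
qed

end

section \<open>Two Curie-Weiss replicas\<close>

text \<open>
  The constant that results from the proof of \<open>sum_configs_overlap_le\<close>; all that matters is
  that it is independent of the size and of the edge density.
\<close>
definition overlap_constant :: "real \<Rightarrow> real" where
  "overlap_constant r = 4 / ((1 - r) * r) * exp ((1 - r) * r / 2) * (1 / (1 - r) + 1 / sqrt (1 - r))"

lemma exp_convex_combination_le:
  fixes a b r :: real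
  assumes "0 \<le> r" "r \<le> 1"
  shows "exp (r * a + (1 - r) * b) \<le> exp a + exp b"
proof -
  have "r * a + (1 - r) * b \<le> max a b"
    using assms by (intro convex_bound_le) auto
  then have "exp (r * a + (1 - r) * b) \<le> exp (max a b)" by simp
  also have "\<dots> \<le> exp a + exp b" by (auto simp: max_def less_imp_le add_increasing add_increasing2)
  finally show ?thesis .
qed

lemma exp_minus_one_le:
  fixes k l y :: real
  assumes "0 \<le> k" "k \<le> l / 2" "0 < l" "0 \<le> y"
  shows "exp (k * y) - 1 \<le> k * (2 / l) * exp (l * y)"
proof -
  have "1 - exp (k * y) * exp (- (k * y)) = 0" by (simp add: exp_minus)
  moreover have "exp (k * y) * (1 + - (k * y)) \<le> exp (k * y) * exp (- (k * y))"
    by (intro mult_left_mono exp_ge_add_one_self) auto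
  ultimately have "exp (k * y) - 1 \<le> k * (y * exp (k * y))" by (simp add: algebra_simps)
  also have "y * exp (k * y) \<le> (2 / l * exp (l / 2 * y)) * exp (l / 2 * y)"
  proof (rule mult_mono)
    have "l / 2 * y \<le> exp (l / 2 * y)" using exp_ge_add_one_self[of "l / 2 * y"] by linarith
    then show "y \<le> 2 / l * exp (l / 2 * y)" using assms by (simp add: field_simps)
    show "exp (k * y) \<le> exp (l / 2 * y)" using mult_right_mono[OF assms(2,4)] by simp
  qed (use assms in auto)
  also have "\<dots> = 2 / l * exp (l * y)" by (simp add: exp_add[symmetric] flip: distrib_right)
  finally show ?thesis using assms by (simp add: mult_left_mono mult.assoc)
qed

text \<open>
  Two independent high-temperature Curie-Weiss configurations have an overlap of order
  \<open>sqrt N\<close>, with bounded square-exponential moments; hence the average of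
  \<open>exp (k * (R\<^sup>2 / N + 1)) - 1\<close>, \<open>R\<close> being the overlap, is of order \<open>k\<close>.

  Under the uniform law \<open>R\<close> is not independent of the pair of magnetizations.  To separate
  them, the exponent is written as a convex combination with weights \<open>r\<close> and \<open>1 - r\<close>, and
  the exponential is bounded by the sum of the two exponentials.  One of them involves the
  magnetizations only and the other one the overlap only, both with coefficient \<open>r < 1\<close>.
\<close>
lemma sum_configs_overlap_le:
  assumes N: "N \<ge> 1" and r: "0 < r" "r < 1"
    and b: "2 * real N * b \<le> r\<^sup>2" and k: "0 \<le> k" "k \<le> (1 - r) * r / 4"
  shows "(\<Sum>\<sigma>\<in>configs N. \<Sum>\<tau>\<in>configs N.
      exp (b * (\<Sum>i=1..N. \<sigma> i)\<^sup>2) * exp (b * (\<Sum>i=1..N. \<tau> i)\<^sup>2) *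
      (exp (k * ((\<Sum>i=1..N. \<sigma> i * \<tau> i)\<^sup>2 / real N + 1)) - 1)) \<le> k * overlap_constant r * (2 ^ N)\<^sup>2"
    (is "?lhs \<le> _")
proof -
  define l where "l = (1 - r) * r / 2"
  have l: "0 < l" using r by (simp add: l_def)
  let ?S = "\<lambda>\<sigma>::nat \<Rightarrow> real. (\<Sum>i=1..N. \<sigma> i)\<^sup>2"
  let ?R = "\<lambda>\<sigma> \<tau>::nat \<Rightarrow> real. (\<Sum>i=1..N. \<sigma> i * \<tau> i)\<^sup>2"
  let ?g = "\<lambda>x. exp (r / (2 * real N) * x)"
  \<comment> \<open>The value of \<open>l\<close> is such that \<open>l * R\<^sup>2 / N\<close> is the share of the weight \<open>1 - r\<close> in the
    convex combination.\<close>
  have term_le: "exp (b * ?S \<sigma>) * exp (b * ?S \<tau>) * (exp (k * (?R \<sigma> \<tau> / real N + 1)) - 1) \<le>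
      k * (2 / l) * exp l * (?g (?S \<sigma>) * ?g (?S \<tau>) + ?g (?R \<sigma> \<tau>))" for \<sigma> \<tau>
  proof -
    have "b \<le> r * (r / (2 * real N))" using b N by (simp add: field_simps power2_eq_square)
    then have "b * (?S \<sigma> + ?S \<tau>) \<le> r * (r / (2 * real N)) * (?S \<sigma> + ?S \<tau>)"
      by (intro mult_right_mono) auto
    moreover have "l * (?R \<sigma> \<tau> / real N + 1) = (1 - r) * (r / (2 * real N) * ?R \<sigma> \<tau>) + l"
      using N by (simp add: l_def field_simps)
    ultimately have "b * (?S \<sigma> + ?S \<tau>) + l * (?R \<sigma> \<tau> / real N + 1) \<le>
        (r * (r / (2 * real N) * (?S \<sigma> + ?S \<tau>)) + (1 - r) * (r / (2 * real N) * ?R \<sigma> \<tau>)) + l"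
      by (simp add: mult.assoc)
    then have "exp (b * (?S \<sigma> + ?S \<tau>) + l * (?R \<sigma> \<tau> / real N + 1)) \<le>
        exp (r * (r / (2 * real N) * (?S \<sigma> + ?S \<tau>)) + (1 - r) * (r / (2 * real N) * ?R \<sigma> \<tau>)) * exp l"
      by (simp only: exp_add[symmetric] exp_le_cancel_iff)
    also have "\<dots> \<le> (exp (r / (2 * real N) * (?S \<sigma> + ?S \<tau>)) + ?g (?R \<sigma> \<tau>)) * exp l"
      using r by (intro mult_right_mono exp_convex_combination_le) auto
    also have "\<dots> = exp l * (?g (?S \<sigma>) * ?g (?S \<tau>) + ?g (?R \<sigma> \<tau>))"
      by (simp only: distrib_left exp_add mult.commute)
    finally have *: "exp (b * (?S \<sigma> + ?S \<tau>) + l * (?R \<sigma> \<tau> / real N + 1)) \<le>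
        exp l * (?g (?S \<sigma>) * ?g (?S \<tau>) + ?g (?R \<sigma> \<tau>))" .
    have "exp (b * ?S \<sigma>) * exp (b * ?S \<tau>) * (exp (k * (?R \<sigma> \<tau> / real N + 1)) - 1) \<le>
        exp (b * ?S \<sigma>) * exp (b * ?S \<tau>) * (k * (2 / l) * exp (l * (?R \<sigma> \<tau> / real N + 1)))"
      using k l by (intro mult_left_mono exp_minus_one_le) (auto simp: l_def)
    also have "\<dots> = k * (2 / l) * exp (b * (?S \<sigma> + ?S \<tau>) + l * (?R \<sigma> \<tau> / real N + 1))"
      by (simp only: exp_add distrib_left mult_ac)
    also have "\<dots> \<le> k * (2 / l) * (exp l * (?g (?S \<sigma>) * ?g (?S \<tau>) + ?g (?R \<sigma> \<tau>)))"
      using k l by (intro mult_left_mono *) auto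
    finally show ?thesis by (simp only: mult.assoc)
  qed
  have "?lhs \<le> (\<Sum>\<sigma>\<in>configs N. \<Sum>\<tau>\<in>configs N. k * (2 / l) * exp l * (?g (?S \<sigma>) * ?g (?S \<tau>) + ?g (?R \<sigma> \<tau>)))"
    by (intro sum_mono term_le)
  also have "\<dots> = k * (2 / l) * exp l * ((\<Sum>\<sigma>\<in>configs N. ?g (?S \<sigma>)) * (\<Sum>\<tau>\<in>configs N. ?g (?S \<tau>)) +
      (\<Sum>\<sigma>\<in>configs N. \<Sum>\<tau>\<in>configs N. ?g (?R \<sigma> \<tau>)))"
    by (simp only: sum_distrib_left[symmetric] sum.distrib sum_product)
  also have "\<dots> \<le> k * (2 / l) * exp l * (2 ^ N / sqrt (1 - r) * (2 ^ N / sqrt (1 - r)) +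
      (\<Sum>\<sigma>\<in>configs N. 2 ^ N / sqrt (1 - r)))"
  proof (intro mult_left_mono add_mono mult_mono sum_mono)
    show "(\<Sum>\<sigma>\<in>configs N. ?g (?S \<sigma>)) \<le> 2 ^ N / sqrt (1 - r)"
      using sum_configs_exp_square_le[of r N "\<lambda>_. 1"] r by simp
    then show "(\<Sum>\<sigma>\<in>configs N. ?g (?S \<sigma>)) \<le> 2 ^ N / sqrt (1 - r)" .
    show "(\<Sum>\<tau>\<in>configs N. ?g (?R \<sigma> \<tau>)) \<le> 2 ^ N / sqrt (1 - r)" if "\<sigma> \<in> configs N" for \<sigma>
      using sum_configs_exp_square_le[of r N \<sigma>] configs_sign[OF that] r by simp
  qed (use r k l in \<open>auto intro!: sum_nonneg\<close>)
  also have "\<dots> = k * (2 / l) * exp l * ((1 / (1 - r) + 1 / sqrt (1 - r)) * (2 ^ N)\<^sup>2)"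
    using r by (simp add: card_configs power2_eq_square algebra_simps)
  also have "\<dots> = k * overlap_constant r * (2 ^ N)\<^sup>2"
    by (simp add: overlap_constant_def l_def)
  finally show ?thesis .
qed

section \<open>Concentration of the Gibbs measure\<close>

context random_edges
begin

text \<open>
  Relative to the squared mean of the full sum, the variance of a partial sum of edge weights is at
  most the two-replica average of \<open>exp (k * (R\<^sup>2 / N + 1)) - 1\<close>.  Since the bound is a sum of
  nonnegative terms it may be extended from \<open>A\<close> to all configurations.
\<close>
lemma
  assumes A: "A \<subseteq> configs N" and N: "N \<ge> 1" and r: "0 < r" "r < 1"
    and t: "0 \<le> t" "t < 1" and u: "real N * t * p \<le> 1 / 2" and b: "2 * real N * artanh (t * p) \<le> r\<^sup>2"
    and k: "2 * t\<^sup>2 * p * real N \<le> k" "k \<le> (1 - r) * r / 4"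
  defines "m \<equiv> \<lambda>A. \<Sum>\<sigma>\<in>A. edge_weight N t (\<lambda>_ _. p) \<sigma>"
  shows integrable_sum_edge_weight_deviation:
      "integrable M (\<lambda>\<omega>. ((\<Sum>\<sigma>\<in>A. edge_weight N t (edge \<omega>) \<sigma>) - m A)\<^sup>2)"
    and sum_edge_weight_variance_le:
      "expectation (\<lambda>\<omega>. ((\<Sum>\<sigma>\<in>A. edge_weight N t (edge \<omega>) \<sigma>) - m A)\<^sup>2) \<le>
        k * overlap_constant r * (m (configs N))\<^sup>2"
proof -
  have fin: "finite A" using A finite_configs finite_subset by blast
  let ?W = "\<lambda>\<omega> \<sigma>. edge_weight N t (edge \<omega>) \<sigma>"
  let ?w = "\<lambda>\<sigma>. edge_weight N t (\<lambda>_ _. p) \<sigma>"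
  let ?R = "\<lambda>\<sigma> \<tau>::nat \<Rightarrow> real. (\<Sum>i=1..N. \<sigma> i * \<tau> i)\<^sup>2"
  let ?S = "\<lambda>\<sigma>::nat \<Rightarrow> real. (\<Sum>i=1..N. \<sigma> i)\<^sup>2"
  have up: "0 \<le> t * p" using t p by simp
  have "1 * (t * p) \<le> real N * (t * p)" using N up by (intro mult_right_mono) auto
  then have up': "t * p \<le> 1 / 2" using u by (simp add: mult.assoc)
  have k0: "0 \<le> k" using k p t by (intro order_trans[OF _ k(1)]) auto
  define c where "c = sqrt (1 - (t * p)\<^sup>2) ^ (N * N)"
  have "(t * p)\<^sup>2 \<le> (1 / 2)\<^sup>2" using up up' by (intro power_mono) auto
  then have tp2: "(t * p)\<^sup>2 \<le> 1 / 4" by (simp add: power2_eq_square)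
  then have c: "c > 0" by (simp add: c_def)
  have w: "?w \<sigma> = c * exp (artanh (t * p) * ?S \<sigma>)" if "\<sigma> \<in> configs N" for \<sigma>
    using edge_weight_const[OF that, of t p] up up' by (simp add: c_def)
  have w0: "0 < ?w \<sigma>" if "\<sigma> \<in> configs N" for \<sigma>
    using w[OF that] c by simp
  have sq: "((\<Sum>\<sigma>\<in>A. ?W \<omega> \<sigma>) - m A)\<^sup>2 =
      (\<Sum>\<sigma>\<in>A. \<Sum>\<tau>\<in>A. ?W \<omega> \<sigma> * ?W \<omega> \<tau> - ?W \<omega> \<sigma> * ?w \<tau> - ?w \<sigma> * ?W \<omega> \<tau> + ?w \<sigma> * ?w \<tau>)" for \<omega>
    unfolding m_def sum_subtractf[symmetric] power2_eq_square sum_product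
    by (intro sum.cong refl) (simp add: algebra_simps)
  have int: "integrable M (\<lambda>\<omega>. ?W \<omega> \<sigma> * ?W \<omega> \<tau>)" if "\<sigma> \<in> A" "\<tau> \<in> A" for \<sigma> \<tau>
    using that A by (intro integrable_edge_weight_mult t) auto
  show "integrable M (\<lambda>\<omega>. ((\<Sum>\<sigma>\<in>A. ?W \<omega> \<sigma>) - m A)\<^sup>2)"
    unfolding sq by (intro Bochner_Integration.integrable_sum Bochner_Integration.integrable_add
        Bochner_Integration.integrable_diff Bochner_Integration.integrable_mult_left
        Bochner_Integration.integrable_mult_right int integrable_edge_weight integrable_const) auto
  have le: "(exp (t\<^sup>2 * p / (1 - (t * p)\<^sup>2)\<^sup>2 * (?R \<sigma> \<tau> + (real N * t * p)\<^sup>2))) \<le> exp (k * (?R \<sigma> \<tau> / real N + 1))"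
    for \<sigma> \<tau>
  proof -
    have "(3 / 4)\<^sup>2 \<le> (1 - (t * p)\<^sup>2)\<^sup>2" using tp2 by (intro power_mono) auto
    then have "1 / 2 \<le> (1 - (t * p)\<^sup>2)\<^sup>2" by (simp add: power2_eq_square)
    then have "t\<^sup>2 * p / (1 - (t * p)\<^sup>2)\<^sup>2 \<le> t\<^sup>2 * p / (1 / 2)"
      using p by (intro divide_left_mono) auto
    also have "\<dots> \<le> k / real N" using k(1) N by (simp add: field_simps)
    finally have K: "t\<^sup>2 * p / (1 - (t * p)\<^sup>2)\<^sup>2 \<le> k / real N" .
    have "(real N * t * p)\<^sup>2 \<le> 1\<^sup>2" using u up by (intro power_mono) (auto simp: mult.assoc)
    then have "(real N * t * p)\<^sup>2 \<le> real N" using N by simp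
    then have "t\<^sup>2 * p / (1 - (t * p)\<^sup>2)\<^sup>2 * (?R \<sigma> \<tau> + (real N * t * p)\<^sup>2) \<le> k / real N * (?R \<sigma> \<tau> + real N)"
      using K k0 by (intro mult_mono) auto
    also have "\<dots> = k * (?R \<sigma> \<tau> / real N + 1)" using N by (simp add: field_simps)
    finally show ?thesis by simp
  qed
  have "expectation (\<lambda>\<omega>. ((\<Sum>\<sigma>\<in>A. ?W \<omega> \<sigma>) - m A)\<^sup>2) =
      (\<Sum>\<sigma>\<in>A. \<Sum>\<tau>\<in>A. expectation (\<lambda>\<omega>. ?W \<omega> \<sigma> * ?W \<omega> \<tau>) - ?w \<sigma> * ?w \<tau>)"
    unfolding sq
    by (simp add: int integrable_edge_weight expectation_edge_weight prob_space)
  also have "\<dots> \<le> (\<Sum>\<sigma>\<in>A. \<Sum>\<tau>\<in>A. ?w \<sigma> * ?w \<tau> * (exp (k * (?R \<sigma> \<tau> / real N + 1)) - 1))"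
  proof (intro sum_mono)
    fix \<sigma> \<tau> assume "\<sigma> \<in> A" "\<tau> \<in> A"
    then have s: "\<sigma> \<in> configs N" "\<tau> \<in> configs N" using A by auto
    have "expectation (\<lambda>\<omega>. ?W \<omega> \<sigma> * ?W \<omega> \<tau>) \<le> ?w \<sigma> * ?w \<tau> * exp (k * (?R \<sigma> \<tau> / real N + 1))"
      using w0[OF s(1)] w0[OF s(2)]
      by (intro order_trans[OF expectation_edge_weight_mult_le[OF s t]] mult_left_mono le) auto
    then show "expectation (\<lambda>\<omega>. ?W \<omega> \<sigma> * ?W \<omega> \<tau>) - ?w \<sigma> * ?w \<tau> \<le>
        ?w \<sigma> * ?w \<tau> * (exp (k * (?R \<sigma> \<tau> / real N + 1)) - 1)"
      by (simp add: right_diff_distrib)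
  qed
  also have "\<dots> \<le> (\<Sum>\<sigma>\<in>configs N. \<Sum>\<tau>\<in>configs N. ?w \<sigma> * ?w \<tau> * (exp (k * (?R \<sigma> \<tau> / real N + 1)) - 1))"
  proof -
    have nn: "0 \<le> ?w \<sigma> * ?w \<tau> * (exp (k * (?R \<sigma> \<tau> / real N + 1)) - 1)"
      if "\<sigma> \<in> configs N" "\<tau> \<in> configs N" for \<sigma> \<tau>
      using w0[OF that(1)] w0[OF that(2)] k0 by simp
    show ?thesis
      unfolding sum.cartesian_product using A nn
      by (intro sum_mono2) (auto simp: case_prod_unfold)
  qed
  also have "\<dots> = c\<^sup>2 * (\<Sum>\<sigma>\<in>configs N. \<Sum>\<tau>\<in>configs N. exp (artanh (t * p) * ?S \<sigma>) *
      exp (artanh (t * p) * ?S \<tau>) * (exp (k * (?R \<sigma> \<tau> / real N + 1)) - 1))"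
    unfolding sum_distrib_left by (intro sum.cong refl) (simp add: w power2_eq_square)
  also have "\<dots> \<le> c\<^sup>2 * (k * overlap_constant r * (2 ^ N)\<^sup>2)"
    by (intro mult_left_mono sum_configs_overlap_le N r b k0 k) auto
  also have "\<dots> = k * overlap_constant r * (c * 2 ^ N)\<^sup>2"
    by (simp add: power_mult_distrib)
  also have "\<dots> \<le> k * overlap_constant r * (m (configs N))\<^sup>2"
  proof (intro mult_left_mono power_mono)
    \<comment> \<open>The Curie-Weiss partition function is at least the number of configurations.\<close>
    have "0 \<le> artanh (t * p)" using up up' by (simp add: artanh_def)
    then have "(\<Sum>\<sigma>\<in>configs N. c * 1) \<le> m (configs N)"
      unfolding m_def using c by (intro sum_mono) (simp add: w)
    then show "c * 2 ^ N \<le> m (configs N)" by (simp add: card_configs mult.commute)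
    show "0 \<le> k * overlap_constant r" using k0 r by (simp add: overlap_constant_def)
  qed (use c in auto)
  finally show "expectation (\<lambda>\<omega>. ((\<Sum>\<sigma>\<in>A. ?W \<omega> \<sigma>) - m A)\<^sup>2) \<le> k * overlap_constant r * (m (configs N))\<^sup>2" .
qed

end

context random_edges
begin

text \<open>
  Let \<open>V\<close> be the sum of all edge weights and \<open>U\<close> the part with magnetization in \<open>A\<close>,
  and let \<open>m\<close> and \<open>c * m\<close> be their means, so that \<open>c\<close> is the Curie-Weiss probability of
  \<open>A\<close>.  For the Gibbs probability \<open>L = U / V\<close> one has \<open>m (L - c) = (U - c m) - L (V - m)\<close>.
  As \<open>0 \<le> L \<le> 1\<close>, the second moments of \<open>U - c m\<close> and \<open>V - m\<close> control that of \<open>L - c\<close>,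
  with no lower bound on the random denominator \<open>V\<close>.
\<close>
lemma prob_magnetization_law_deviation_le:
  assumes A: "A \<in> sets borel" and N: "N \<ge> 1" and r: "0 < r" "r < 1" and p0: "p > 0"
    and \<beta>: "0 < \<beta>" "\<beta> < 1" and \<eta>: "\<eta> > 0"
    and t: "t = tanh (\<beta> / (2 * real N * p))"
    and b: "2 * real N * artanh (t * p) \<le> r\<^sup>2" and k: "1 / (real N * p) \<le> (1 - r) * r / 4"
  shows "prob {\<omega> \<in> space M. \<eta> \<le> \<bar>measure (magnetization_law N p \<beta> (\<lambda>i j. e i j \<omega>)) A -
      measure (curie_weiss_law N (2 * real N * artanh (t * p))) A\<bar>} \<le>
    4 * overlap_constant r / \<eta>\<^sup>2 * (1 / (real N * p))"
proof -
  let ?W = "\<lambda>\<omega> \<sigma>. edge_weight N t (edge \<omega>) \<sigma>"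
  let ?w = "\<lambda>\<sigma>. edge_weight N t (\<lambda>_ _. p) \<sigma>"
  define c where "c = measure (curie_weiss_law N (2 * real N * artanh (t * p))) A"
  define m where "m = (\<Sum>\<sigma>\<in>configs N. ?w \<sigma>)"
  define V where "V \<omega> = (\<Sum>\<sigma>\<in>configs N. ?W \<omega> \<sigma>)" for \<omega>
  define U where "U \<omega> = (\<Sum>\<sigma>\<in>configs_in N A. ?W \<omega> \<sigma>)" for \<omega>
  have Np: "0 < real N * p" using N p0 by simp
  have "0 < \<beta> / (2 * real N * p)" using N p0 \<beta> by simp
  then have t0: "0 \<le> t" "t < 1" "t \<le> \<beta> / (2 * real N * p)"
    using tanh_le_self[of "\<beta> / (2 * real N * p)"] tanh_real_lt_1 unfolding t by auto
  have Nt: "real N * t * p \<le> 1 / 2"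
  proof -
    have "real N * t * p \<le> real N * (\<beta> / (2 * real N * p)) * p"
      using t0 p0 by (intro mult_right_mono mult_left_mono) auto
    also have "\<dots> = \<beta> / 2" using N p0 by simp
    finally show ?thesis using \<beta> by simp
  qed
  have k': "2 * t\<^sup>2 * p * real N \<le> 1 / (real N * p)"
  proof -
    have "(real N * t * p)\<^sup>2 \<le> (1 / 2)\<^sup>2" using Nt t0 p0 by (intro power_mono) auto
    then have "2 * t\<^sup>2 * p * real N * (real N * p) \<le> 1" by (simp add: power2_eq_square mult_ac)
    then show ?thesis using Np by (simp add: le_divide_eq)
  qed
  have "1 * (t * p) \<le> real N * (t * p)" using N t0 p0 by (intro mult_right_mono) auto
  then have u: "\<bar>t * p\<bar> < 1" using Nt t0 p0 by (simp add: mult.assoc)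
  have w0: "0 < ?w \<sigma>" if "\<sigma> \<in> configs N" for \<sigma>
    using edge_weight_pos[OF that t0(1,2)] p by auto
  then have m: "0 < m" unfolding m_def using configs_nonempty by (intro sum_pos) auto
  have sub: "configs_in N A \<subseteq> configs N" by (auto simp: configs_in_def)
  have c: "(\<Sum>\<sigma>\<in>configs_in N A. ?w \<sigma>) = c * m"
    using measure_curie_weiss_law[OF A N u] m by (simp add: c_def m_def)
  note dev = integrable_sum_edge_weight_deviation[OF _ N r t0(1,2) Nt b k' k]
    and var = sum_edge_weight_variance_le[OF _ N r t0(1,2) Nt b k' k]
  have int: "integrable M (\<lambda>\<omega>. (V \<omega> - m)\<^sup>2)" "integrable M (\<lambda>\<omega>. (U \<omega> - c * m)\<^sup>2)"
    using dev[of "configs N"] dev[OF sub] by (simp_all add: V_def U_def m_def c[unfolded m_def])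
  have E: "expectation (\<lambda>\<omega>. (V \<omega> - m)\<^sup>2) \<le> 1 / (real N * p) * overlap_constant r * m\<^sup>2"
    "expectation (\<lambda>\<omega>. (U \<omega> - c * m)\<^sup>2) \<le> 1 / (real N * p) * overlap_constant r * m\<^sup>2"
    using var[of "configs N"] var[OF sub] by (simp_all add: V_def U_def m_def c[unfolded m_def])
  define Y where "Y \<omega> = 2 / m\<^sup>2 * ((V \<omega> - m)\<^sup>2 + (U \<omega> - c * m)\<^sup>2)" for \<omega>
  have Y: "integrable M Y" unfolding Y_def using int by simp
  have "AE \<omega> in M. (measure (magnetization_law N p \<beta> (\<lambda>i j. e i j \<omega>)) A - c)\<^sup>2 \<le> Y \<omega>"
    using AE_edge
  proof eventually_elim
    case (elim \<omega>)
    define L where "L = measure (magnetization_law N p \<beta> (\<lambda>i j. e i j \<omega>)) A"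
    have "e i j \<omega> = edge \<omega> i j" if "i \<in> {1..N}" "j \<in> {1..N}" for i j
      using elim that by (force simp: indicator_def)
    then have "edge_weight N t (\<lambda>i j. e i j \<omega>) \<sigma> = ?W \<omega> \<sigma>" for \<sigma>
      unfolding edge_weight_def by (intro prod.cong refl) auto
    then have L: "L = U \<omega> / V \<omega>"
      using measure_magnetization_law_edge_weight[OF A, of N "\<lambda>i j. e i j \<omega>" p \<beta>] elim
      by (simp add: L_def U_def V_def t)
    have "0 < V \<omega>" unfolding V_def using configs_nonempty t0
      by (intro sum_pos edge_weight_pos) (auto simp: indicator_def)
    then have UL: "U \<omega> = L * V \<omega>" using L by simp
    interpret law: prob_space "magnetization_law N p \<beta> (\<lambda>i j. e i j \<omega>)"
      by (rule prob_space_magnetization_law)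
    have "0 \<le> L" "L \<le> 1" by (auto simp: L_def)
    then have L2: "L\<^sup>2 \<le> 1" by (simp add: abs_square_le_1)
    have "m * (L - c) = (U \<omega> - c * m) - L * (V \<omega> - m)" by (simp add: UL algebra_simps)
    then have "m\<^sup>2 * (L - c)\<^sup>2 = ((U \<omega> - c * m) - L * (V \<omega> - m))\<^sup>2"
      by (metis power_mult_distrib)
    also have "\<dots> \<le> 2 * (U \<omega> - c * m)\<^sup>2 + 2 * (L * (V \<omega> - m))\<^sup>2"
      using sum_squares_ge_zero[of "(U \<omega> - c * m) + L * (V \<omega> - m)" 0]
      by (simp add: power2_eq_square algebra_simps)
    also have "(L * (V \<omega> - m))\<^sup>2 \<le> (V \<omega> - m)\<^sup>2"
      unfolding power_mult_distrib using mult_right_mono[OF L2, of "(V \<omega> - m)\<^sup>2"] by simp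
    finally have "(L - c)\<^sup>2 * m\<^sup>2 \<le> 2 * ((V \<omega> - m)\<^sup>2 + (U \<omega> - c * m)\<^sup>2)"
      by (simp add: mult.commute)
    then have "(L - c)\<^sup>2 \<le> 2 * ((V \<omega> - m)\<^sup>2 + (U \<omega> - c * m)\<^sup>2) / m\<^sup>2"
      using m by (subst pos_le_divide_eq) auto
    then show ?case by (simp add: Y_def L_def)
  qed
  then have "AE \<omega> in M. \<eta> \<le> \<bar>measure (magnetization_law N p \<beta> (\<lambda>i j. e i j \<omega>)) A - c\<bar> \<longrightarrow> \<eta>\<^sup>2 \<le> Y \<omega>"
  proof eventually_elim
    case (elim \<omega>)
    then show ?case using \<eta>
      by (auto intro!: order_trans[OF _ elim] simp: abs_le_square_iff[symmetric])
  qed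
  then have "prob {\<omega> \<in> space M. \<eta> \<le> \<bar>measure (magnetization_law N p \<beta> (\<lambda>i j. e i j \<omega>)) A - c\<bar>} \<le>
      prob {\<omega> \<in> space M. \<eta>\<^sup>2 \<le> Y \<omega>}"
    using Y by (intro finite_measure_mono_AE) auto
  also have "\<dots> \<le> expectation Y / \<eta>\<^sup>2"
    using \<eta> by (intro integral_Markov_inequality_measure[OF Y sets.top]) (auto simp: Y_def)
  also have "expectation Y = 2 / m\<^sup>2 * (expectation (\<lambda>\<omega>. (V \<omega> - m)\<^sup>2) + expectation (\<lambda>\<omega>. (U \<omega> - c * m)\<^sup>2))"
    unfolding Y_def using int by simp
  also have "\<dots> \<le> 2 / m\<^sup>2 * (1 / (real N * p) * overlap_constant r * m\<^sup>2 + 1 / (real N * p) * overlap_constant r * m\<^sup>2)"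
    by (intro mult_left_mono add_mono E) auto
  also have "\<dots> = 4 * overlap_constant r * (1 / (real N * p))"
    using m by (simp add: field_simps)
  finally show ?thesis
    by (simp add: c_def divide_right_mono ac_simps)
qed

lemma measurable_measure_magnetization_law:
  "A \<in> sets borel \<Longrightarrow> (\<lambda>\<omega>. measure (magnetization_law N p \<beta> (\<lambda>i j. e i j \<omega>)) A) \<in> borel_measurable M"
  unfolding measure_magnetization_law partition_function_def hamiltonian_def
  using measurable_e by measurable

end

section \<open>The Levy distance and finite grids\<close>

lemma levy_dist_leI:
  assumes \<epsilon>: "\<epsilon> > 0"
    and "\<And>t. measure \<mu> {..t - \<epsilon>} - \<epsilon> \<le> measure \<nu> {..t}"
    and "\<And>t. measure \<nu> {..t} \<le> measure \<mu> {..t + \<epsilon>} + \<epsilon>"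
  shows "levy_dist \<mu> \<nu> \<le> \<epsilon>"
  unfolding levy_dist_def using assms by (intro cInf_lower bdd_belowI[of _ 0]) auto

text \<open>
  Take a grid of mesh \<open>\<epsilon>\<close> outside of which \<open>\<nu>\<close> has mass less than \<open>\<epsilon> / 2\<close> on either
  side.  Between grid points monotonicity of the distribution functions suffices, because the Levy
  distance permits a horizontal shift by \<open>\<epsilon>\<close>.
\<close>
lemma levy_dist_le_finite_grid:
  assumes \<nu>: "real_distribution \<nu>" and \<epsilon>: "\<epsilon> > 0"
  obtains T where "finite T"
    "\<And>\<mu>. real_distribution \<mu> \<Longrightarrow> (\<And>s. s \<in> T \<Longrightarrow> \<bar>measure \<mu> {..s} - measure \<nu> {..s}\<bar> \<le> \<epsilon> / 2) \<Longrightarrow>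
      levy_dist \<mu> \<nu> \<le> \<epsilon>"
proof -
  interpret \<nu>: real_distribution \<nu> by fact
  have "eventually (\<lambda>x. cdf \<nu> x < \<epsilon> / 2) at_bot"
    using \<nu>.cdf_lim_at_bot \<epsilon> by (intro order_tendstoD) auto
  then obtain a where a: "measure \<nu> {..a} < \<epsilon> / 2"
    by (auto simp: cdf_def eventually_at_bot_linorder)
  have "eventually (\<lambda>x. 1 - \<epsilon> / 2 < cdf \<nu> x) at_top"
    using \<nu>.cdf_lim_at_top_prob \<epsilon> by (intro order_tendstoD) auto
  then obtain b where b: "1 - \<epsilon> / 2 < measure \<nu> {..s}" if "s \<ge> b" for s
    by (auto simp: cdf_def eventually_at_top_linorder)
  obtain n :: nat where n: "(b - a) / \<epsilon> \<le> real n" using real_arch_simple by blast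
  define l where "l = a + real n * \<epsilon>"
  have l: "b \<le> l" using n \<epsilon> by (simp add: l_def field_simps)
  define T where "T = (\<lambda>i. a + real i * \<epsilon>) ` {..n}"
  have T: "a \<in> T" "l \<in> T" by (auto simp: T_def l_def intro: image_eqI[of _ _ 0])
  have grid: "x \<le> a \<or> l \<le> x \<or> (\<exists>s\<in>T. x \<le> s \<and> s \<le> x + \<epsilon>)" for x
  proof (cases "a < x \<and> x < l")
    case True
    define i where "i = nat \<lceil>(x - a) / \<epsilon>\<rceil>"
    have q: "0 < (x - a) / \<epsilon>" "(x - a) / \<epsilon> \<le> real n"
      using True \<epsilon> by (auto simp: l_def field_simps)
    then have "i \<le> n" unfolding i_def by (simp add: ceiling_le_iff nat_le_iff)
    have "real i = of_int \<lceil>(x - a) / \<epsilon>\<rceil>" unfolding i_def using q(1) by simp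
    then have "(x - a) / \<epsilon> \<le> real i" "real i \<le> (x - a) / \<epsilon> + 1"
      by linarith+
    then have "x \<le> a + real i * \<epsilon>" "a + real i * \<epsilon> \<le> x + \<epsilon>"
      using \<epsilon> by (auto simp: field_simps)
    then show ?thesis using \<open>i \<le> n\<close> by (auto simp: T_def)
  qed auto
  show thesis
  proof (rule that)
    show "finite T" by (simp add: T_def)
    fix \<mu> assume "real_distribution \<mu>" and close: "\<And>s. s \<in> T \<Longrightarrow> \<bar>measure \<mu> {..s} - measure \<nu> {..s}\<bar> \<le> \<epsilon> / 2"
    then interpret \<mu>: real_distribution \<mu> by simp
    have mono: "measure \<mu> {..x} \<le> measure \<mu> {..y}" "measure \<nu> {..x} \<le> measure \<nu> {..y}" if "x \<le> y" for x y
      using that by (auto intro!: \<mu>.finite_measure_mono \<nu>.finite_measure_mono)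
    note a' = close[OF T(1)] and l' = close[OF T(2)] and b' = b[OF l]
    show "levy_dist \<mu> \<nu> \<le> \<epsilon>"
    proof (rule levy_dist_leI[OF \<epsilon>])
      fix t
      show "measure \<mu> {..t - \<epsilon>} - \<epsilon> \<le> measure \<nu> {..t}"
        using grid[of "t - \<epsilon>"]
      proof (elim disjE bexE conjE)
        assume "t - \<epsilon> \<le> a"
        with mono(1)[of "t - \<epsilon>" a] a a' measure_nonneg[of \<nu> "{..t}"] show ?thesis by linarith
      next
        assume "l \<le> t - \<epsilon>"
        with mono(2)[of l t] \<epsilon> b' \<mu>.prob_le_1[of "{..t - \<epsilon>}"] show ?thesis by linarith
      next
        fix s assume "s \<in> T" "t - \<epsilon> \<le> s" "s \<le> t - \<epsilon> + \<epsilon>"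
        with mono(1)[of "t - \<epsilon>" s] mono(2)[of s t] close[of s] \<epsilon> show ?thesis by linarith
      qed
      show "measure \<nu> {..t} \<le> measure \<mu> {..t + \<epsilon>} + \<epsilon>"
        using grid[of t]
      proof (elim disjE bexE conjE)
        assume "t \<le> a"
        with mono(2)[of t a] a measure_nonneg[of \<mu> "{..t + \<epsilon>}"] \<epsilon> show ?thesis by linarith
      next
        assume "l \<le> t"
        with mono(1)[of l "t + \<epsilon>"] \<epsilon> b' l' \<nu>.prob_le_1[of "{..t}"] show ?thesis by linarith
      next
        fix s assume "s \<in> T" "t \<le> s" "s \<le> t + \<epsilon>"
        with mono(2)[of t s] mono(1)[of s "t + \<epsilon>"] close[of s] \<epsilon> show ?thesis by linarith
      qed
    qed
  qed
qed

section \<open>Convergence in probability\<close>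

text \<open>
  Both \<open>tanh\<close> and \<open>artanh\<close> are tangent to the identity at 0, and the arguments
  \<open>\<beta> / (2 N p)\<close> and \<open>t p\<close>, which is of order \<open>1 / N\<close>, tend to 0.
\<close>
lemma effective_temperature_tendsto:
  fixes p :: "nat \<Rightarrow> real"
  assumes p: "filterlim (\<lambda>N. p N * real N) at_top sequentially"
  shows "(\<lambda>N. 2 * real N * artanh (tanh (\<beta> / (2 * real N * p N)) * p N)) \<longlonglongrightarrow> \<beta>"
proof -
  have "(tanh has_field_derivative (1::real)) (at 0)"
    by (auto intro!: derivative_eq_intros)
  then obtain g where g: "\<And>x::real. tanh x = g x * x" "isCont g 0" "g 0 = 1"
    unfolding CARAT_DERIV by auto
  have "(artanh has_field_derivative (1::real)) (at 0)"
    by (auto intro!: derivative_eq_intros)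
  then obtain h where h: "\<And>x::real. artanh x = h x * x" "isCont h 0" "h 0 = 1"
    unfolding CARAT_DERIV by auto
  define x where "x N = \<beta> / (2 * real N * p N)" for N
  have "(\<lambda>N. \<beta> / 2 * inverse (p N * real N)) \<longlonglongrightarrow> \<beta> / 2 * 0"
    by (intro tendsto_mult tendsto_const tendsto_inverse_0_at_top p)
  then have x: "x \<longlonglongrightarrow> 0" unfolding x_def by (simp add: field_simps)
  have gx: "(\<lambda>N. g (x N)) \<longlonglongrightarrow> 1" using isCont_tendsto_compose[OF g(2) x] g(3) by simp
  have pos: "eventually (\<lambda>N. 0 < p N * real N) sequentially"
    using p by (simp add: filterlim_at_top_dense)
  have y: "(\<lambda>N. \<beta> / 2 * g (x N)) \<longlonglongrightarrow> \<beta> / 2" using tendsto_mult[OF tendsto_const[of "\<beta> / 2"] gx] by simp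
  have tp: "eventually (\<lambda>N. tanh (x N) * p N = \<beta> / 2 * g (x N) * (1 / real N)) sequentially"
    using pos
  proof eventually_elim
    case (elim N)
    then have "x N * p N = \<beta> / 2 * (1 / real N)" by (auto simp: x_def)
    moreover have "tanh (x N) * p N = g (x N) * (x N * p N)" using g(1)[of "x N"] by simp
    ultimately show ?case by simp
  qed
  have "(\<lambda>N. \<beta> / 2 * g (x N) * (1 / real N)) \<longlonglongrightarrow> \<beta> / 2 * 0"
    by (intro tendsto_mult[OF y] lim_1_over_n)
  then have "(\<lambda>N. tanh (x N) * p N) \<longlonglongrightarrow> 0" using tp by (simp add: tendsto_cong)
  from isCont_tendsto_compose[OF h(2) this] h(3)
  have "(\<lambda>N. 2 * (h (tanh (x N) * p N) * (\<beta> / 2 * g (x N)))) \<longlonglongrightarrow> 2 * (1 * (\<beta> / 2))"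
    by (intro tendsto_mult tendsto_const y) simp
  moreover have "eventually (\<lambda>N. 2 * (h (tanh (x N) * p N) * (\<beta> / 2 * g (x N))) =
      2 * real N * artanh (tanh (x N) * p N)) sequentially"
    using tp pos
  proof eventually_elim
    case (elim N)
    have "2 * real N * artanh (tanh (x N) * p N) = 2 * real N * (h (tanh (x N) * p N) * (\<beta> / 2 * g (x N) * (1 / real N)))"
      by (simp only: h(1)[of "tanh (x N) * p N"] elim(1)[symmetric])
    then show ?case using elim(2) by (cases "N = 0") auto
  qed
  ultimately show ?thesis by (simp add: tendsto_cong x_def)
qed

theorem theorem1p1:
  fixes \<beta> :: real
    and p :: "nat \<Rightarrow> real"
    and M :: "nat \<Rightarrow> 'a measure"
    and e :: "nat \<Rightarrow> nat \<Rightarrow> nat \<Rightarrow> 'a \<Rightarrow> real"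
  assumes "0 < \<beta>" and "\<beta> < 1"
    and "\<And>N. N \<ge> 1 \<Longrightarrow> p N \<in> {0<..1}"
    and "filterlim (\<lambda>N. p N * real N) at_top sequentially"
    and "\<And>N. N \<ge> 1 \<Longrightarrow> prob_space (M N)"
    and "\<And>N. N \<ge> 1 \<Longrightarrow>
           prob_space.indep_vars (M N) (\<lambda>_. borel) (\<lambda>(i, j). e N i j) ({1..N} \<times> {1..N})"
    and "\<And>N i j. N \<ge> 1 \<Longrightarrow> i \<in> {1..N} \<Longrightarrow> j \<in> {1..N} \<Longrightarrow>
           measure (M N) {\<omega> \<in> space (M N). e N i j \<omega> = 1} = p N"
    and "\<And>N i j. N \<ge> 1 \<Longrightarrow> i \<in> {1..N} \<Longrightarrow> j \<in> {1..N} \<Longrightarrow>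
           measure (M N) {\<omega> \<in> space (M N). e N i j \<omega> = 0} = 1 - p N"
  shows "\<forall>\<epsilon>>0. (\<lambda>N. measure (M N)
           {\<omega> \<in> space (M N).
              levy_dist (magnetization_law N (p N) \<beta> (\<lambda>i j. e N i j \<omega>)) (normal_law 0 (1 / (1 - \<beta>))) > \<epsilon>})
         \<longlonglongrightarrow> 0"
proof (intro allI impI)
  fix \<epsilon> :: real assume \<epsilon>: "\<epsilon> > 0"
  let ?\<nu> = "normal_law 0 (1 / (1 - \<beta>))"
  let ?L = "\<lambda>N \<omega>. magnetization_law N (p N) \<beta> (\<lambda>i j. e N i j \<omega>)"
  define t where "t N = tanh (\<beta> / (2 * real N * p N))" for N
  define b where "b N = 2 * real N * artanh (t N * p N)" for N
  define r where "r = sqrt ((1 + \<beta>) / 2)"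
  have r: "0 < r" "r < 1" "\<beta> < r\<^sup>2" using assms(1,2) by (auto simp: r_def)
  \<comment> \<open>Any number between \<open>\<beta>\<close> and 1 would do for \<open>r\<^sup>2\<close>.\<close>
  have b0: "0 \<le> b N" for N
  proof (cases "N = 0")
    case False
    then have N: "0 < p N" "p N \<le> 1" "N \<ge> 1" using assms(3)[of N] by auto
    have "0 \<le> t N" "t N < 1" using N assms(1) tanh_real_lt_1 by (auto simp: t_def)
    moreover from this N have "t N * p N \<le> t N * 1" by (intro mult_left_mono) auto
    ultimately have "0 \<le> t N * p N" "t N * p N < 1" using N by auto
    then show ?thesis by (simp add: b_def artanh_def)
  qed (simp add: b_def)
  have b: "b \<longlonglongrightarrow> \<beta>"
    unfolding b_def t_def by (rule effective_temperature_tendsto[OF assms(4)])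
  obtain T where T: "finite T" and levy: "\<And>\<mu>. real_distribution \<mu> \<Longrightarrow>
      (\<And>s. s \<in> T \<Longrightarrow> \<bar>measure \<mu> {..s} - measure ?\<nu> {..s}\<bar> \<le> \<epsilon> / 2) \<Longrightarrow> levy_dist \<mu> ?\<nu> \<le> \<epsilon>"
    using levy_dist_le_finite_grid[OF _ \<epsilon>, of ?\<nu>] real_distribution_normal_law assms(2) by auto
  have inv: "(\<lambda>N. 1 / (real N * p N)) \<longlonglongrightarrow> 0"
    using tendsto_inverse_0_at_top[OF assms(4)] by (simp add: field_simps)
  have small: "eventually (\<lambda>N. 1 / (real N * p N) < (1 - r) * r / 4) sequentially"
    using r by (intro order_tendstoD(2)[OF inv]) simp
  \<comment> \<open>The admitted error \<open>\<epsilon> / 2\<close> at a grid point is split evenly between the Gibbs measure against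
    the Curie-Weiss law and the Curie-Weiss law against the normal law.\<close>
  have "eventually (\<lambda>N. \<forall>s\<in>T. \<bar>measure (curie_weiss_law N (b N)) {..s} - measure ?\<nu> {..s}\<bar> < \<epsilon> / 4) sequentially"
    using T tendstoD[OF curie_weiss_law_cdf_tendsto[OF b b0 assms(2)], of "\<epsilon> / 4"] \<epsilon>
    by (intro eventually_ball_finite) (auto simp: dist_real_def)
  then have bound: "eventually (\<lambda>N. measure (M N) {\<omega> \<in> space (M N). levy_dist (?L N \<omega>) ?\<nu> > \<epsilon>} \<le>
      real (card T) * (4 * overlap_constant r / (\<epsilon> / 4)\<^sup>2 * (1 / (real N * p N)))) sequentially"
    using order_tendstoD(2)[OF b r(3)] small eventually_ge_at_top[of 1]
  proof (eventually_elim)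
    case (elim N)
    interpret random_edges "M N" N "p N" "e N"
      using assms(3)[of N] assms(5-8)[of N] elim
      by (auto simp: random_edges_def random_edges_axioms_def)
    let ?B = "\<lambda>s. {\<omega> \<in> space (M N). \<epsilon> / 4 \<le> \<bar>measure (?L N \<omega>) {..s} - measure (curie_weiss_law N (b N)) {..s}\<bar>}"
    have B: "?B s \<in> events" for s
      using measurable_measure_magnetization_law[of "{..s}" \<beta>] by measurable
    have "{\<omega> \<in> space (M N). levy_dist (?L N \<omega>) ?\<nu> > \<epsilon>} \<subseteq> (\<Union>s\<in>T. ?B s)"
    proof
      fix \<omega> assume \<omega>: "\<omega> \<in> {\<omega> \<in> space (M N). levy_dist (?L N \<omega>) ?\<nu> > \<epsilon>}"
      have "real_distribution (?L N \<omega>)"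
        using prob_space_magnetization_law by (simp add: real_distribution_def real_distribution_axioms_def)
      with \<omega> levy obtain s where s: "s \<in> T" "\<epsilon> / 2 < \<bar>measure (?L N \<omega>) {..s} - measure ?\<nu> {..s}\<bar>"
        by fastforce
      moreover have "\<bar>measure (curie_weiss_law N (b N)) {..s} - measure ?\<nu> {..s}\<bar> < \<epsilon> / 4"
        using elim s by auto
      ultimately have "\<epsilon> / 4 \<le> \<bar>measure (?L N \<omega>) {..s} - measure (curie_weiss_law N (b N)) {..s}\<bar>"
        by linarith
      then show "\<omega> \<in> (\<Union>s\<in>T. ?B s)" using s \<omega> by auto
    qed
    then have "prob {\<omega> \<in> space (M N). levy_dist (?L N \<omega>) ?\<nu> > \<epsilon>} \<le> prob (\<Union>s\<in>T. ?B s)"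
      using B T by (intro finite_measure_mono) auto
    also have "\<dots> \<le> (\<Sum>s\<in>T. prob (?B s))"
      using B T by (intro finite_measure_subadditive_finite) auto
    also have "\<dots> \<le> (\<Sum>s\<in>T. 4 * overlap_constant r / (\<epsilon> / 4)\<^sup>2 * (1 / (real N * p N)))"
      unfolding b_def
      using elim assms(1,2) assms(3)[of N] r \<epsilon>
      by (intro sum_mono prob_magnetization_law_deviation_le) (auto simp: t_def b_def)
    finally show ?case by simp
  qed
  have lim: "(\<lambda>N. real (card T) * (4 * overlap_constant r / (\<epsilon> / 4)\<^sup>2 * (1 / (real N * p N)))) \<longlonglongrightarrow> 0"
    by (intro tendsto_mult_right_zero inv)
  show "(\<lambda>N. measure (M N) {\<omega> \<in> space (M N). levy_dist (?L N \<omega>) ?\<nu> > \<epsilon>}) \<longlonglongrightarrow> 0"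
    by (rule tendsto_sandwich[OF _ bound tendsto_const lim]) simp
qed

end
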